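(* There exists a sufficiently small absolute constant $c>0$ such that, whenever $d\le c\log n$, the following holds: any algorithm that, given $\varepsilon\in(0,1]$ and i.i.d. samples from an arbitrary degree-$d$ Bayes net $P$ over $\{0,1\}^n$, distinguishes with probability at least $2/3$ between the cases ($P$ is a product distribution) and ($d_{\mathrm{TV}}(P,Q)\ge\varepsilon$ for every product distribution $Q$ on $\{0,1\}^n$) must use $\Omega(2^{d/2}n/\varepsilon^2)$ samples.
   Context: A distribution $P$ on $\{0,1\}^n$ is a degree-$d$ Bayes net if there is a directed acyclic graph on $[n]$ in which every node has at most $d$ parents such that $P(x)=\prod_{i}P(x_i\mid x_{\Pi_i})$, where $\Pi_i$ is the parent set of $i$. A product distribution has mutually independent coordinates. $d_{\mathrm{TV}}(P,Q)=\frac12\sum_x|P(x)-Q(x)|$. $\Omega(\cdot)$ hides an absolute positive constant.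
   Formalization: The claim fails for d = 0 and for ε = 1 or too close to 1 given n (no net is far from product). It is proved for d ≥ 1 and ε ≤ ε₀, for every fixed ε₀ < 1, with the Ω-constant and a threshold n ≥ n₀ depending only on ε₀; c is absolute. *)

theory Defs
  imports "HOL-Probability.Probability"
begin

text \<open>
  Points of \<open>{0,1}^n\<close> are functions \<open>nat \<Rightarrow> bool\<close> with coordinates indexed by \<open>{..<n}\<close>; the
  coordinates outside this range are pinned to \<open>False\<close>, so that a point is determined by its
  first \<open>n\<close> coordinates.
\<close>

definition cube :: "nat \<Rightarrow> (nat \<Rightarrow> bool) set" where
  "cube n = {x. \<forall>i\<ge>n. \<not> x i}"

definition dist_on_cube :: "nat \<Rightarrow> (nat \<Rightarrow> bool) pmf \<Rightarrow> bool" where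
  "dist_on_cube n P \<longleftrightarrow> set_pmf P \<subseteq> cube n"

definition product_dist :: "nat \<Rightarrow> (nat \<Rightarrow> bool) pmf \<Rightarrow> bool" where
  "product_dist n P \<longleftrightarrow> dist_on_cube n P \<and>
     prob_space.indep_vars (measure_pmf P) (\<lambda>_. count_space UNIV) (\<lambda>i x. x i) {..<n}"

definition d_TV :: "nat \<Rightarrow> (nat \<Rightarrow> bool) pmf \<Rightarrow> (nat \<Rightarrow> bool) pmf \<Rightarrow> real" where
  "d_TV n P Q = (1/2) * (\<Sum>x\<in>cube n. \<bar>pmf P x - pmf Q x\<bar>)"

text \<open>\<open>pa i\<close> is the parent set of node \<open>i\<close>; acyclicity also excludes self-loops.\<close>

definition parent_dag :: "nat \<Rightarrow> nat \<Rightarrow> (nat \<Rightarrow> nat set) \<Rightarrow> bool" where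
  "parent_dag n d pa \<longleftrightarrow>
     (\<forall>i<n. pa i \<subseteq> {..<n} \<and> card (pa i) \<le> d) \<and> acyclic {(j, i). i < n \<and> j \<in> pa i}"

text \<open>
  Conditional probabilities given a null event are \<open>0\<close> here, which agrees with the usual
  convention of arbitrary conditional probability tables there: if \<open>x\<close> restricted to some \<open>pa i\<close>
  has probability \<open>0\<close>, then so has \<open>x\<close>, and both sides of the factorization are \<open>0\<close>. Conversely,
  if the factorization holds at all other \<open>x\<close>, any choice of the tables on null events gives a
  product of total mass \<open>1\<close> that agrees with \<open>P\<close> wherever \<open>P\<close> lives, hence everywhere.
\<close>

definition bayes_net :: "nat \<Rightarrow> nat \<Rightarrow> (nat \<Rightarrow> bool) pmf \<Rightarrow> bool" where
  "bayes_net n d P \<longleftrightarrow> dist_on_cube n P \<and>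
     (\<exists>pa. parent_dag n d pa \<and>
        (\<forall>x\<in>cube n. pmf P x =
           (\<Prod>i<n. cond_prob (measure_pmf P) (\<lambda>y. y i = x i) (\<lambda>y. \<forall>j\<in>pa i. y j = x j))))"

definition far_from_product :: "nat \<Rightarrow> real \<Rightarrow> (nat \<Rightarrow> bool) pmf \<Rightarrow> bool" where
  "far_from_product n \<epsilon> P \<longleftrightarrow> (\<forall>Q. product_dist n Q \<longrightarrow> d_TV n P Q \<ge> \<epsilon>)"

text \<open>
  A randomized algorithm that draws \<open>m\<close> samples is a map from sample lists to distributions on
  answers, with \<open>True\<close> meaning ``product'' and \<open>False\<close> meaning ``far from every product
  distribution''. \<open>output_dist m A P\<close> is the law of its answer on \<open>m\<close> i.i.d. samples from \<open>P\<close>.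
\<close>

type_synonym algorithm = "(nat \<Rightarrow> bool) list \<Rightarrow> bool pmf"

definition output_dist :: "nat \<Rightarrow> algorithm \<Rightarrow> (nat \<Rightarrow> bool) pmf \<Rightarrow> bool pmf" where
  "output_dist m A P = bind_pmf (replicate_pmf m P) A"

definition independence_tester :: "nat \<Rightarrow> nat \<Rightarrow> real \<Rightarrow> nat \<Rightarrow> algorithm \<Rightarrow> bool" where
  "independence_tester n d \<epsilon> m A \<longleftrightarrow>
     (\<forall>P. bayes_net n d P \<longrightarrow>
        (product_dist n P \<longrightarrow> pmf (output_dist m A P) True \<ge> 2/3) \<and>
        (far_from_product n \<epsilon> P \<longrightarrow> pmf (output_dist m A P) False \<ge> 2/3))"

end

theory Submission
  imports Defs
begin

text \<open>
  The hard instances consist of a constant number of independent blocks, each with \<open>k = d - 1\<close>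
  pointer bits, \<open>N\<close> candidate bits and \<open>N\<close> leaves. All bits are fair; leaf \<open>i\<close> has correlation
  \<open>\<plusminus>\<delta>\<close>, \<open>\<delta> \<sim> \<epsilon> / sqrt N\<close>, with one candidate bit of its block, the sign being a function of the
  pointer bits. The candidate and the sign function are uniformly random, independently for each
  leaf.

  Indistinguishability from the uniform distribution: the likelihood ratio of the mixture is a
  product over the leaves, and given all other columns the leaf columns are independent. Hence the
  relative entropy is a sum over the leaves, each term being at most a chi-square divergence. There
  two different candidates contribute nothing, so agreement of the candidates gains a factor \<open>1 / N\<close>,
  and the random signs give at most \<open>exp (m\<^sup>2 \<delta>\<^sup>4 / 2\<^sup>k) - 1\<close>.

  Distance from product distributions: an odd function of the leaf-candidate correlations has mean
  zero under any product distribution with fair candidate bits, but mean of order \<open>\<delta> sqrt N\<close>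
  under every instance. This is linear in \<open>\<epsilon>\<close>; Bhattacharyya coefficients multiply over the
  blocks, which pushes the distance above any \<open>\<epsilon>\<^sub>0 < 1\<close>.
\<close>

section \<open>Means over finite sets and the cube\<close>

definition mean :: "'a set \<Rightarrow> ('a \<Rightarrow> 'b::field_char_0) \<Rightarrow> 'b" where
  "mean S F = (\<Sum>x\<in>S. F x) / of_nat (card S)"

lemma mean_cong: "(\<And>x. x \<in> S \<Longrightarrow> F x = G x) \<Longrightarrow> mean S F = mean S G"
  by (simp add: mean_def)

lemma mean_add: "mean S (\<lambda>x. F x + G x) = mean S F + mean S G"
  by (simp add: mean_def sum.distrib add_divide_distrib)

lemma mean_diff: "mean S (\<lambda>x. F x - G x) = mean S F - mean S G"
  by (simp add: mean_def sum_subtractf diff_divide_distrib)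

lemma mean_cmult: "mean S (\<lambda>x. c * F x) = c * mean S F"
  by (simp add: mean_def sum_distrib_left)

lemma mean_multc: "mean S (\<lambda>x. F x * c) = mean S F * c"
  by (simp add: mean_def sum_distrib_right)

lemma mean_divide: "mean S (\<lambda>x. F x / c) = mean S F / c"
  by (simp add: mean_def sum_divide_distrib mult.commute)

lemma mean_sum: "mean S (\<lambda>x. \<Sum>i\<in>I. F i x) = (\<Sum>i\<in>I. mean S (F i))"
  unfolding mean_def by (subst sum.swap) (simp add: sum_divide_distrib)

lemma mean_const: "finite S \<Longrightarrow> S \<noteq> {} \<Longrightarrow> mean S (\<lambda>x. c) = c"
  by (simp add: mean_def)

lemma mean_mono:
  fixes F G :: "'a \<Rightarrow> real"
  shows "(\<And>x. x \<in> S \<Longrightarrow> F x \<le> G x) \<Longrightarrow> mean S F \<le> mean S G"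
  by (simp add: mean_def divide_right_mono sum_mono)

lemma mean_nonneg:
  fixes F :: "'a \<Rightarrow> real"
  shows "(\<And>x. x \<in> S \<Longrightarrow> 0 \<le> F x) \<Longrightarrow> 0 \<le> mean S F"
  by (simp add: mean_def sum_nonneg)

lemma abs_mean_le:
  fixes F :: "'a \<Rightarrow> real"
  shows "\<bar>mean S F\<bar> \<le> mean S (\<lambda>x. \<bar>F x\<bar>)"
  by (simp add: mean_def divide_right_mono)

lemma mean_swap: "mean S (\<lambda>x. mean T (F x)) = mean T (\<lambda>y. mean S (\<lambda>x. F x y))"
  unfolding mean_def sum_divide_distrib[symmetric] by (subst sum.swap) (simp add: field_simps)

lemma mean_Times: "mean (S \<times> T) F = mean S (\<lambda>x. mean T (\<lambda>y. F (x, y)))"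
  by (simp add: mean_def sum.cartesian_product sum_divide_distrib[symmetric] card_cartesian_product)

lemma mean_reindex: "bij_betw h S T \<Longrightarrow> mean T F = mean S (\<lambda>x. F (h x))"
  by (simp add: mean_def sum.reindex_bij_betw bij_betw_same_card)

lemma mean_PiE_prod:
  assumes "finite I" "\<And>i. i \<in> I \<Longrightarrow> finite (S i)"
  shows "mean (PiE I S) (\<lambda>h. \<Prod>i\<in>I. F i (h i)) = (\<Prod>i\<in>I. mean (S i) (F i))"
  using assms by (simp add: mean_def prod_dividef prod_sum_PiE card_PiE)

section \<open>Cauchy-Schwarz, Hellinger distance and relative entropy\<close>

lemma Cauchy_Schwarz_mean:
  fixes F G :: "'a \<Rightarrow> real"
  shows "(mean S (\<lambda>x. F x * G x))\<^sup>2 \<le> mean S (\<lambda>x. (F x)\<^sup>2) * mean S (\<lambda>x. (G x)\<^sup>2)"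
  using Cauchy_Schwarz_ineq_sum[of F G S]
  by (simp add: mean_def power_divide power2_eq_square[of "of_nat _"] divide_right_mono)

text \<open>Cauchy-Schwarz for \<open>F - G = (sqrt F - sqrt G) * (sqrt F + sqrt G)\<close>. It
  serves twice: to bound total variation by relative entropy, and to relate it to the Bhattacharyya
  coefficient.\<close>

lemma mean_abs_diff_sqrt:
  fixes F G :: "'a \<Rightarrow> real"
  assumes "\<And>x. x \<in> S \<Longrightarrow> 0 \<le> F x" "\<And>x. x \<in> S \<Longrightarrow> 0 \<le> G x"
  shows "(mean S (\<lambda>x. \<bar>F x - G x\<bar>))\<^sup>2
    \<le> mean S (\<lambda>x. (sqrt (F x) - sqrt (G x))\<^sup>2) * mean S (\<lambda>x. (sqrt (F x) + sqrt (G x))\<^sup>2)"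
proof -
  have "mean S (\<lambda>x. \<bar>F x - G x\<bar>)
      = mean S (\<lambda>x. \<bar>sqrt (F x) - sqrt (G x)\<bar> * \<bar>sqrt (F x) + sqrt (G x)\<bar>)"
  proof (rule mean_cong)
    fix x assume "x \<in> S"
    then have "F x - G x = (sqrt (F x) - sqrt (G x)) * (sqrt (F x) + sqrt (G x))"
      using assms by (simp add: algebra_simps)
    then show "\<bar>F x - G x\<bar> = \<bar>sqrt (F x) - sqrt (G x)\<bar> * \<bar>sqrt (F x) + sqrt (G x)\<bar>"
      by (metis abs_mult)
  qed
  then show ?thesis
    using Cauchy_Schwarz_mean[of S "\<lambda>x. \<bar>sqrt (F x) - sqrt (G x)\<bar>" "\<lambda>x. \<bar>sqrt (F x) + sqrt (G x)\<bar>"]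
    by simp
qed

text \<open>A Pinsker-type inequality for a density \<open>L\<close>, with constant 4 in place of
  the optimal 2. The detour over the Hellinger distance needs only
  \<open>ln y \<le> y - 1\<close>.\<close>

lemma mean_abs_diff_one_le_relative_entropy:
  fixes L :: "'a \<Rightarrow> real"
  assumes S: "finite S" "S \<noteq> {}" and pos: "\<And>x. x \<in> S \<Longrightarrow> 0 < L x" and one: "mean S L = 1"
  shows "(mean S (\<lambda>x. \<bar>L x - 1\<bar>))\<^sup>2 \<le> 4 * mean S (\<lambda>x. L x * ln (L x))"
proof -
  have a: "mean S (\<lambda>x. (sqrt (L x) - sqrt 1)\<^sup>2) \<le> mean S (\<lambda>x. L x * ln (L x) - L x + 1)"
  proof (rule mean_mono)
    fix x assume "x \<in> S"
    then have L: "0 < L x" by (rule pos)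
    \<comment> \<open>This makes the comparison pointwise; the extra term \<open>- L x + 1\<close>
      averages to zero.\<close>
    have "ln (1 / sqrt (L x)) \<le> 1 / sqrt (L x) - 1"
      using L by (intro ln_le_minus_one) simp
    then have "2 - 2 / sqrt (L x) \<le> ln (L x)"
      using L by (simp add: ln_div ln_sqrt)
    then have "L x * (2 - 2 / sqrt (L x)) \<le> L x * ln (L x)"
      using L by (intro mult_left_mono) auto
    moreover have "L x * (2 - 2 / sqrt (L x)) = 2 * L x - 2 * (L x / sqrt (L x))"
      by (simp add: algebra_simps)
    then have "L x * (2 - 2 / sqrt (L x)) = 2 * L x - 2 * sqrt (L x)"
      using L by (simp add: real_div_sqrt)
    ultimately show "(sqrt (L x) - sqrt 1)\<^sup>2 \<le> L x * ln (L x) - L x + 1"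
      using L by (simp add: power2_diff)
  qed
  have b: "mean S (\<lambda>x. (sqrt (L x) + sqrt 1)\<^sup>2) \<le> mean S (\<lambda>x. 2 * L x + 2)"
  proof (rule mean_mono)
    fix x assume "x \<in> S"
    then have L: "0 < L x" by (rule pos)
    have "0 \<le> (sqrt (L x) - 1)\<^sup>2" by simp
    then show "(sqrt (L x) + sqrt 1)\<^sup>2 \<le> 2 * L x + 2"
      using L by (simp add: power2_diff power2_sum)
  qed
  have "(mean S (\<lambda>x. \<bar>L x - 1\<bar>))\<^sup>2
      \<le> mean S (\<lambda>x. (sqrt (L x) - sqrt 1)\<^sup>2) * mean S (\<lambda>x. (sqrt (L x) + sqrt 1)\<^sup>2)"
    using pos by (intro mean_abs_diff_sqrt) (auto intro: less_imp_le)
  also have "\<dots> \<le> mean S (\<lambda>x. L x * ln (L x) - L x + 1) * mean S (\<lambda>x. 2 * L x + 2)"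
    using a b by (intro mult_mono' mean_nonneg) auto
  also have "\<dots> = mean S (\<lambda>x. L x * ln (L x)) * 4"
    using S one by (simp add: mean_add mean_diff mean_cmult mean_const)
  finally show ?thesis by simp
qed

section \<open>Uniform averages over cubes and functions of few coordinates\<close>

definition cube_on :: "nat set \<Rightarrow> (nat \<Rightarrow> bool) set" where
  "cube_on V = {x. \<forall>i. x i \<longrightarrow> i \<in> V}"

lemma cube_eq_cube_on: "cube n = cube_on {..<n}"
  by (auto simp: cube_def cube_on_def not_le[symmetric])

lemma cube_on_eq_image: "cube_on V = (\<lambda>S i. i \<in> S) ` Pow V"
proof
  show "cube_on V \<subseteq> (\<lambda>S i. i \<in> S) ` Pow V"
  proof
    fix x assume "x \<in> cube_on V"
    then show "x \<in> (\<lambda>S i. i \<in> S) ` Pow V"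
      by (intro image_eqI[of _ _ "{i. x i}"]) (auto simp: cube_on_def)
  qed
qed (auto simp: cube_on_def)

lemma finite_cube_on [simp]: "finite V \<Longrightarrow> finite (cube_on V)"
  by (simp add: cube_on_eq_image)

lemma card_cube_on: "finite V \<Longrightarrow> card (cube_on V) = 2 ^ card V"
  unfolding cube_on_eq_image
  by (subst card_image) (auto simp: inj_on_def card_Pow fun_eq_iff)

lemma cube_on_nonempty [simp]: "cube_on V \<noteq> {}"
  by (auto simp: cube_on_def intro: exI[of _ "\<lambda>_. False"])

definition depends :: "nat set \<Rightarrow> ((nat \<Rightarrow> bool) \<Rightarrow> 'b) \<Rightarrow> bool" where
  "depends V F \<longleftrightarrow> (\<forall>x y. (\<forall>i\<in>V. x i = y i) \<longrightarrow> F x = F y)"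

lemma dependsD: "depends V F \<Longrightarrow> (\<And>i. i \<in> V \<Longrightarrow> x i = y i) \<Longrightarrow> F x = F y"
  by (auto simp: depends_def)

lemma depends_mono: "depends V F \<Longrightarrow> V \<subseteq> W \<Longrightarrow> depends W F"
  by (auto simp: depends_def subset_iff)

lemma depends_mult: "depends V F \<Longrightarrow> depends V G \<Longrightarrow> depends V (\<lambda>x. F x * G x)"
  unfolding depends_def by metis

lemma depends_comp: "depends V F \<Longrightarrow> depends V (\<lambda>x. f (F x))"
  by (simp add: depends_def) metis

lemma depends_prod: "(\<And>i. i \<in> I \<Longrightarrow> depends V (F i)) \<Longrightarrow> depends V (\<lambda>x. \<Prod>i\<in>I. F i x)"
  unfolding depends_def by (metis (no_types, lifting) prod.cong)

definition flip :: "nat set \<Rightarrow> (nat \<Rightarrow> bool) \<Rightarrow> nat \<Rightarrow> bool" where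
  "flip A x = (\<lambda>i. if i \<in> A then \<not> x i else x i)"

lemma bij_flip: "A \<subseteq> V \<Longrightarrow> bij_betw (flip A) (cube_on V) (cube_on V)"
  by (rule bij_betw_byWitness[where f' = "flip A"]) (auto simp: flip_def cube_on_def split: if_splits)

lemma mean_flip: "A \<subseteq> V \<Longrightarrow> mean (cube_on V) F = mean (cube_on V) (\<lambda>x. F (flip A x))"
  by (rule mean_reindex[OF bij_flip])

text \<open>Flipping coordinate \<open>i\<close> preserves the uniform distribution, so this
  coordinate may be averaged first with all others held fixed.\<close>

lemma mean_resample:
  assumes "i \<in> V"
  shows "mean (cube_on V) F = mean (cube_on V) (\<lambda>x. (F (x(i := True)) + F (x(i := False))) / 2)"
proof -
  have "F (x(i := True)) + F (x(i := False)) = F x + F (flip {i} x)" for x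
  proof (cases "x i")
    case True
    then have "x(i := True) = x" "x(i := False) = flip {i} x" by (auto simp: flip_def fun_eq_iff)
    then show ?thesis by simp
  next
    case False
    then have "x(i := True) = flip {i} x" "x(i := False) = x" by (auto simp: flip_def fun_eq_iff)
    then show ?thesis by simp
  qed
  then have "mean (cube_on V) (\<lambda>x. (F (x(i := True)) + F (x(i := False))) / 2)
      = (mean (cube_on V) F + mean (cube_on V) (\<lambda>x. F (flip {i} x))) / 2"
    by (simp add: mean_add mean_divide)
  then show ?thesis
    using mean_flip[of "{i}" V F] assms by simp
qed

text \<open>Each \<open>i\<close> in \<open>B\<close> is read by its own factor \<open>g i\<close>
  only, and averaging over it leaves the constant \<open>w i\<close> whatever the other coordinates
  are. So the leaves can be integrated out one at a time.\<close>

lemma mean_leaves: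
  fixes G :: "(nat \<Rightarrow> bool) \<Rightarrow> 'b::field_char_0"
  assumes "finite B" "B \<subseteq> V" "depends (- B) G"
    and "\<And>i. i \<in> B \<Longrightarrow> depends (- (B - {i})) (g i)"
    and "\<And>i x. i \<in> B \<Longrightarrow> (g i (x(i := True)) + g i (x(i := False))) / 2 = w i"
  shows "mean (cube_on V) (\<lambda>x. G x * (\<Prod>i\<in>B. g i x)) = mean (cube_on V) G * (\<Prod>i\<in>B. w i)"
  using assms
proof (induction B rule: finite_induct)
  case empty
  then show ?case by simp
next
  case (insert i B)
  have G: "G (x(i := b)) = G x" for x b
    using insert.prems(2) by (rule dependsD) auto
  have g: "g j (x(i := b)) = g j x" if "j \<in> B" for j x b
    using insert.prems(3)[of j] insert.hyps that by (intro dependsD[of _ "g j"]) auto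
  have step: "((G x * (g i (x(i:=True)) * c) + G x * (g i (x(i:=False)) * c)) / 2)
      = G x * c * w i" for x c
  proof -
    have "w i = (g i (x(i:=True)) + g i (x(i:=False))) / 2"
      by (rule insert.prems(4)[symmetric]) simp
    then show ?thesis by (simp add: field_simps)
  qed
  have "mean (cube_on V) (\<lambda>x. G x * (\<Prod>j\<in>insert i B. g j x))
      = mean (cube_on V) (\<lambda>x. G x * (\<Prod>j\<in>B. g j x) * w i)"
    using insert.prems(1) insert.hyps
    by (subst mean_resample[of i]) (auto simp: G g step)
  also have "\<dots> = mean (cube_on V) (\<lambda>x. G x * (\<Prod>j\<in>B. g j x)) * w i"
    by (rule mean_multc)
  also have "mean (cube_on V) (\<lambda>x. G x * (\<Prod>j\<in>B. g j x)) = mean (cube_on V) G * (\<Prod>j\<in>B. w j)"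
  proof (rule insert.IH)
    show "depends (- B) G"
      using insert.prems(2) by (rule depends_mono) auto
    show "depends (- (B - {j})) (g j)" if "j \<in> B" for j
      using that by (intro depends_mono[OF insert.prems(3)]) auto
  qed (use insert.prems in auto)
  finally show ?case
    using insert.hyps by simp
qed

text \<open>Two independent uniform points \<open>x\<close> and \<open>y\<close> may exchange their
  coordinates outside \<open>S\<close>; this turns \<open>F x * G x\<close> into
  \<open>F x * G y\<close>.\<close>

lemma mean_indep:
  fixes F G :: "(nat \<Rightarrow> bool) \<Rightarrow> 'b::field_char_0"
  assumes F: "depends S F" and G: "depends (- S) G"
  shows "mean (cube_on V) (\<lambda>x. F x * G x) = mean (cube_on V) F * mean (cube_on V) G"
proof -
  define h where "h = (\<lambda>(x, y). ((\<lambda>i. if i \<in> S then x i else y i), (\<lambda>i. if i \<in> S then y i else (x i :: bool))))"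
  have "bij_betw h (cube_on V \<times> cube_on V) (cube_on V \<times> cube_on V)"
    by (rule bij_betw_byWitness[where f' = h]) (auto simp: h_def cube_on_def split: if_splits)
  then have "mean (cube_on V \<times> cube_on V) (\<lambda>(x, y). F x * G x)
      = mean (cube_on V \<times> cube_on V) (\<lambda>p. case h p of (x, y) \<Rightarrow> F x * G x)"
    by (rule mean_reindex)
  also have "\<dots> = mean (cube_on V \<times> cube_on V) (\<lambda>(x, y). F x * G y)"
  proof (rule mean_cong, clarify)
    fix x y :: "nat \<Rightarrow> bool"
    have "F (\<lambda>i. if i \<in> S then x i else y i) = F x" "G (\<lambda>i. if i \<in> S then x i else y i) = G y"
      by (rule dependsD[OF F] dependsD[OF G]; simp)+
    then show "(case h (x, y) of (x, y) \<Rightarrow> F x * G x) = F x * G y"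
      by (simp add: h_def)
  qed
  finally have *: "mean (cube_on V) (\<lambda>x. mean (cube_on V) (\<lambda>y. F x * G x))
      = mean (cube_on V) F * mean (cube_on V) G"
    by (simp add: mean_Times mean_cmult mean_multc)
  have "mean (cube_on V) (\<lambda>y. c) = (c :: 'b)" if "finite (cube_on V)" for c
    using that by (simp add: mean_const)
  \<comment> \<open>An infinite cube has cardinality \<open>0\<close>, so all means over it are
    divisions by \<open>0\<close>, hence \<open>0\<close>.\<close>
  with * show ?thesis
    by (cases "finite (cube_on V)") (auto simp: mean_def)
qed

lemma mean_blocks:
  fixes F :: "'c \<Rightarrow> (nat \<Rightarrow> bool) \<Rightarrow> 'b::field_char_0"
  assumes "finite V" "finite I" "\<And>r. r \<in> I \<Longrightarrow> depends (S r) (F r)" "disjoint_family_on S I"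
  shows "mean (cube_on V) (\<lambda>x. \<Prod>r\<in>I. F r x) = (\<Prod>r\<in>I. mean (cube_on V) (F r))"
  using assms(2-)
proof (induction I rule: finite_induct)
  case empty
  then show ?case using assms(1) by (simp add: mean_const)
next
  case (insert r I)
  have "mean (cube_on V) (\<lambda>x. F r x * (\<Prod>r\<in>I. F r x))
      = mean (cube_on V) (F r) * mean (cube_on V) (\<lambda>x. \<Prod>r\<in>I. F r x)"
  proof (rule mean_indep)
    show "depends (S r) (F r)" using insert.prems by simp
    show "depends (- S r) (\<lambda>x. \<Prod>r\<in>I. F r x)"
    proof (rule depends_prod)
      fix q assume q: "q \<in> I"
      with insert have "S q \<inter> S r = {}" by (auto simp: disjoint_family_on_def)
      with q insert.prems(1)[of q] show "depends (- S r) (F q)"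
        by (auto intro: depends_mono)
    qed
  qed
  moreover have "disjoint_family_on S I"
    using insert.prems(2) by (auto simp: disjoint_family_on_def)
  ultimately show ?case using insert by simp
qed

definition restr :: "nat set \<Rightarrow> (nat \<Rightarrow> bool) \<Rightarrow> nat \<Rightarrow> bool" where
  "restr V x = (\<lambda>i. i \<in> V \<and> x i)"

lemma restr_in_cube_on [simp]: "restr V x \<in> cube_on V"
  by (simp add: restr_def cube_on_def)

lemma mean_restr:
  assumes "finite V" "Z \<subseteq> V"
  shows "mean (cube_on V) (\<lambda>x. F (restr Z x)) = mean (cube_on Z) F"
proof -
  have "finite Z" using assms by (rule rev_finite_subset)
  have bij: "bij_betw (\<lambda>(x, y) i. if i \<in> Z then x i else y i) (cube_on Z \<times> cube_on (V - Z)) (cube_on V)"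
  proof (rule bij_betw_byWitness[where f' = "\<lambda>x. (restr Z x, restr (V - Z) x)"])
    show "\<forall>p\<in>cube_on Z \<times> cube_on (V - Z). (\<lambda>x. (restr Z x, restr (V - Z) x))
        ((\<lambda>(x, y) i. if i \<in> Z then x i else y i) p) = p"
      by (auto simp: restr_def cube_on_def fun_eq_iff)
    show "\<forall>x\<in>cube_on V. (\<lambda>(x, y) i. if i \<in> Z then x i else y i)
        ((\<lambda>x. (restr Z x, restr (V - Z) x)) x) = x"
      by (auto simp: restr_def cube_on_def fun_eq_iff)
    show "(\<lambda>(x, y) i. if i \<in> Z then x i else y i) ` (cube_on Z \<times> cube_on (V - Z)) \<subseteq> cube_on V"
      using assms by (auto simp: cube_on_def split: if_splits)
  qed auto
  have *: "restr Z (\<lambda>i. if i \<in> Z then x i else y i) = x" if "x \<in> cube_on Z" for x y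
    using that by (auto simp: restr_def cube_on_def fun_eq_iff)
  have "mean (cube_on V) (\<lambda>x. F (restr Z x))
      = mean (cube_on Z \<times> cube_on (V - Z)) (\<lambda>(x, y). F (restr Z (\<lambda>i. if i \<in> Z then x i else y i)))"
    by (subst mean_reindex[OF bij]) (simp add: case_prod_unfold)
  also have "\<dots> = mean (cube_on Z) F"
    using assms by (auto simp: mean_Times mean_const * split del: if_split intro!: mean_cong)
  finally show ?thesis .
qed

section \<open>Samples and the likelihood ratio of the mixture\<close>

definition samples :: "nat \<Rightarrow> 'a set \<Rightarrow> 'a list set" where
  "samples m S = {xs. set xs \<subseteq> S \<and> length xs = m}"

lemma finite_samples [simp]: "finite S \<Longrightarrow> finite (samples m S)"
  by (simp add: samples_def finite_lists_length_eq)

lemma samples_nonempty: "S \<noteq> {} \<Longrightarrow> samples m S \<noteq> {}"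
proof -
  assume "S \<noteq> {}"
  then obtain a where "a \<in> S" by auto
  then have "replicate m a \<in> samples m S" by (auto simp: samples_def)
  then show ?thesis by auto
qed

lemma mean_samples_0: "mean (samples 0 S) G = G []"
proof -
  have "samples 0 S = {[]}" by (auto simp: samples_def)
  then show ?thesis by (simp add: mean_def)
qed

lemma mean_samples_Suc:
  "mean (samples (Suc m) S) G = mean S (\<lambda>x. mean (samples m S) (\<lambda>xs. G (x # xs)))"
proof -
  have "bij_betw (\<lambda>(x, xs). x # xs) (S \<times> samples m S) (samples (Suc m) S)"
    by (rule bij_betw_byWitness[where f' = "\<lambda>xs. (hd xs, tl xs)"])
       (auto simp: samples_def length_Suc_conv)
  then show ?thesis
    by (subst mean_reindex) (auto simp: mean_Times)
qed

lemma mean_samples_prod_list: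
  "mean (samples m S) (\<lambda>xs. \<Prod>x\<leftarrow>xs. F x) = (mean S F) ^ m"
  by (induction m) (simp_all add: mean_samples_0 mean_samples_Suc mean_cmult mean_multc)

text \<open>Column \<open>i\<close> consists of bit \<open>i\<close> of every sample. Not reading it
  is expressed as invariance under erasing it.\<close>

definition column_free :: "nat \<Rightarrow> ((nat \<Rightarrow> bool) list \<Rightarrow> 'b) \<Rightarrow> bool" where
  "column_free i G \<longleftrightarrow> (\<forall>xs. G (map (\<lambda>x. x(i := False)) xs) = G xs)"

text \<open>Given all other columns, the bits of column \<open>i\<close> are independent and fair,
  so each factor \<open>u x\<close> averages to 1. The induction removes one sample at a time and
  therefore generalizes \<open>G\<close>.\<close>

lemma mean_samples_leaf:
  fixes G :: "(nat \<Rightarrow> bool) list \<Rightarrow> 'b::field_char_0"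
  assumes i: "i \<in> V" and G: "column_free i G"
    and u: "\<And>x. (u (x(i := True)) + u (x(i := False))) / 2 = 1"
  shows "mean (samples m (cube_on V)) (\<lambda>xs. G xs * (\<Prod>x\<leftarrow>xs. u x)) = mean (samples m (cube_on V)) G"
  using G
proof (induction m arbitrary: G)
  case 0
  then show ?case by (simp add: mean_samples_0)
next
  case (Suc m)
  define g where "g x = mean (samples m (cube_on V)) (\<lambda>xs. G (x # xs))" for x
  have G: "G (map (\<lambda>x. x(i := False)) xs) = G xs" for xs
    using Suc.prems by (auto simp: column_free_def)
  \<comment> \<open>Erasing is idempotent, so with the first sample fixed the function of the others
    is again column-free.\<close>
  have G': "G (x # map (\<lambda>x. x(i := False)) xs) = G (x # xs)" for x xs
  proof -
    have "G (x # map (\<lambda>x. x(i := False)) xs)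
        = G (map (\<lambda>x. x(i := False)) (x # map (\<lambda>x. x(i := False)) xs))"
      by (rule G[symmetric])
    also have "\<dots> = G (map (\<lambda>x. x(i := False)) (x # xs))"
      by (simp add: comp_def)
    finally show ?thesis by (simp only: G)
  qed
  have "G (x(i := b) # xs) = G (x # xs)" for x b xs
    using G[of "x(i := b) # xs"] G[of "x # xs"] by simp
  then have g: "g (x(i := b)) = g x" for x b
    by (simp add: g_def)
  have "mean (samples (Suc m) (cube_on V)) (\<lambda>xs. G xs * (\<Prod>x\<leftarrow>xs. u x))
      = mean (cube_on V) (\<lambda>x. u x * mean (samples m (cube_on V)) (\<lambda>xs. G (x # xs) * (\<Prod>x\<leftarrow>xs. u x)))"
    by (simp add: mean_samples_Suc mean_cmult[symmetric] mult_ac)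
  also have "\<dots> = mean (cube_on V) (\<lambda>x. u x * g x)"
    unfolding g_def by (subst Suc.IH) (auto simp: column_free_def G')
  also have "\<dots> = mean (cube_on V) (\<lambda>x. g x * ((u (x(i := True)) + u (x(i := False))) / 2))"
    using i by (subst mean_resample[of i]) (auto simp: g field_simps)
  also have "\<dots> = mean (cube_on V) g"
    by (simp only: u mult_1_right)
  also have "\<dots> = mean (samples (Suc m) (cube_on V)) G"
    by (simp add: g_def[abs_def] mean_samples_Suc)
  finally show ?case .
qed

section \<open>Edges with random signs\<close>

definition chi :: "bool \<Rightarrow> real" where
  "chi b = (if b then 1 else - 1)"

lemma chi_simps [simp]: "chi True = 1" "chi False = - 1" "chi b * chi b = 1" "\<bar>chi b\<bar> = 1"
  "chi (\<not> b) = - chi b"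
  by (auto simp: chi_def)

text \<open>A leaf \<open>i\<close> carries a pair \<open>(j, s)\<close>: its parent outside the pointer set \<open>Z\<close> is \<open>j\<close>, and the
  sign of their correlation is \<open>s\<close> of the pointer bits.\<close>

definition signs :: "nat set \<Rightarrow> ((nat \<Rightarrow> bool) \<Rightarrow> real) set" where
  "signs Z = (\<Pi>\<^sub>E z\<in>cube_on Z. {- 1, 1})"

definition edge :: "nat set \<Rightarrow> nat \<times> ((nat \<Rightarrow> bool) \<Rightarrow> real) \<Rightarrow> nat \<Rightarrow> (nat \<Rightarrow> bool) \<Rightarrow> real" where
  "edge Z p i x = snd p (restr Z x) * chi (x (fst p)) * chi (x i)"

lemma signsD: "s \<in> signs Z \<Longrightarrow> z \<in> cube_on Z \<Longrightarrow> s z = - 1 \<or> s z = 1"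
  by (auto simp: signs_def dest: PiE_mem)

lemma finite_signs [simp]: "finite Z \<Longrightarrow> finite (signs Z)"
  by (simp add: signs_def finite_PiE)

lemma signs_nonempty [simp]: "signs Z \<noteq> {}"
  by (simp add: signs_def PiE_eq_empty_iff)

lemma edge_cases:
  assumes "snd p \<in> signs Z"
  shows "edge Z p i x = 1 \<or> edge Z p i x = - 1"
  using signsD[OF assms, of "restr Z x"] by (auto simp: edge_def chi_def)

lemma edge_upd_self:
  assumes "i \<notin> Z" "fst p \<noteq> i"
  shows "edge Z p i (x(i := b)) = snd p (restr Z x) * chi (x (fst p)) * chi b"
proof -
  have "restr Z (x(i := b)) = restr Z x" using assms by (auto simp: restr_def)
  then show ?thesis using assms by (simp add: edge_def)
qed

lemma depends_edge: "Z \<subseteq> W \<Longrightarrow> fst p \<in> W \<Longrightarrow> i \<in> W \<Longrightarrow> depends W (edge Z p i)"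
proof -
  assume W: "Z \<subseteq> W" "fst p \<in> W" "i \<in> W"
  show ?thesis unfolding depends_def
  proof (intro allI impI)
    fix x y :: "nat \<Rightarrow> bool" assume eq: "\<forall>i\<in>W. x i = y i"
    then have "restr Z x = restr Z y" using W by (auto simp: restr_def)
    with W eq show "edge Z p i x = edge Z p i y" by (simp add: edge_def)
  qed
qed

text \<open>A crude bound on \<open>cosh t\<close>, from
  \<open>exp t \<le> 1 + t + t\<^sup>2\<close> and
  \<open>exp (- t) \<le> 1 - t + t\<^sup>2\<close>.\<close>

lemma exp_add_exp_minus_le:
  fixes t :: real
  assumes "0 \<le> t" "t \<le> 1"
  shows "(exp t + exp (- t)) / 2 \<le> exp (t\<^sup>2)"
proof -
  have "exp (- t) \<le> 1 / (1 + t)"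
    using assms exp_ge_add_one_self[of t] by (simp add: exp_minus divide_simps)
  also have "\<dots> \<le> 1 - t + t\<^sup>2"
  proof -
    have "(1 - t + t\<^sup>2) * (1 + t) = 1 + t ^ 3" by (simp add: algebra_simps power2_eq_square power3_eq_cube)
    then show ?thesis using assms by (simp add: divide_simps)
  qed
  finally have "(exp t + exp (- t)) / 2 \<le> 1 + t\<^sup>2"
    using exp_bound[OF assms] by simp
  also have "\<dots> \<le> exp (t\<^sup>2)" by (rule exp_ge_add_one_self)
  finally show ?thesis .
qed

text \<open>Bounding \<open>1 + y\<close> by \<open>exp y\<close> turns the power into a product
  over the pointer values \<open>z\<close>, whose signs \<open>s' z\<close> are independent. Each of
  the \<open>2 ^ card Z\<close> factors averages to \<open>cosh t \<le> exp (t\<^sup>2)\<close> for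
  \<open>t = m * \<delta>\<^sup>2 / 2 ^ card Z\<close>; the last hypothesis says
  \<open>t \<le> 1\<close>.\<close>

lemma mean_signs_power_le:
  fixes m :: nat and \<delta> :: real
  assumes Z: "finite Z" and s: "s \<in> signs Z" and \<delta>: "\<bar>\<delta>\<bar> \<le> 1" and t: "real m * \<delta>\<^sup>2 \<le> 2 ^ card Z"
  shows "mean (signs Z) (\<lambda>s'. (1 + \<delta>\<^sup>2 * mean (cube_on Z) (\<lambda>z. s z * s' z)) ^ m)
    \<le> exp ((real m)\<^sup>2 * \<delta> ^ 4 / 2 ^ card Z)"
proof -
  define D where "D = (2::real) ^ card Z"
  define t where "t = real m * \<delta>\<^sup>2 / D"
  have D: "D > 0" by (simp add: D_def)
  have t01: "0 \<le> t" "t \<le> 1" using assms(4) D by (auto simp: t_def D_def)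
  have "mean (signs Z) (\<lambda>s'. (1 + \<delta>\<^sup>2 * mean (cube_on Z) (\<lambda>z. s z * s' z)) ^ m)
      \<le> mean (signs Z) (\<lambda>s'. \<Prod>z\<in>cube_on Z. exp (t * (s z * s' z)))"
  proof (rule mean_mono)
    fix s' assume s': "s' \<in> signs Z"
    define c where "c = mean (cube_on Z) (\<lambda>z. s z * s' z)"
    have "\<bar>s z * s' z\<bar> \<le> 1" if "z \<in> cube_on Z" for z
      using signsD[OF s that] signsD[OF s' that] by auto
    then have "\<bar>c\<bar> \<le> mean (cube_on Z) (\<lambda>z. 1)"
      unfolding c_def by (intro order_trans[OF abs_mean_le] mean_mono)
    then have "\<bar>c\<bar> \<le> 1" using Z by (simp add: mean_const)
    moreover have "\<delta>\<^sup>2 \<le> 1" using \<delta> by (simp add: abs_square_le_1)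
    ultimately have "\<bar>\<delta>\<^sup>2 * c\<bar> \<le> 1 * 1"
      unfolding abs_mult by (intro mult_mono) auto
    then have "0 \<le> 1 + \<delta>\<^sup>2 * c" by linarith
    then have "(1 + \<delta>\<^sup>2 * c) ^ m \<le> exp (\<delta>\<^sup>2 * c) ^ m"
      by (intro power_mono exp_ge_add_one_self) auto
    also have "\<dots> = exp (real m * (\<delta>\<^sup>2 * c))"
      by (simp add: exp_of_nat_mult)
    also have "real m * (\<delta>\<^sup>2 * c) = (\<Sum>z\<in>cube_on Z. t * (s z * s' z))"
      using Z by (simp add: c_def mean_def t_def D_def card_cube_on sum_distrib_left sum_divide_distrib mult_ac)
    also have "exp \<dots> = (\<Prod>z\<in>cube_on Z. exp (t * (s z * s' z)))"
      using Z by (simp add: exp_sum)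
    finally show "(1 + \<delta>\<^sup>2 * mean (cube_on Z) (\<lambda>z. s z * s' z)) ^ m
        \<le> (\<Prod>z\<in>cube_on Z. exp (t * (s z * s' z)))"
      by (simp add: c_def)
  qed
  also have "\<dots> = (\<Prod>z\<in>cube_on Z. mean {- 1, 1} (\<lambda>\<sigma>. exp (t * (s z * \<sigma>))))"
    unfolding signs_def using Z by (intro mean_PiE_prod) auto
  also have "\<dots> \<le> (\<Prod>z\<in>cube_on Z. exp (t\<^sup>2))"
  proof (intro prod_mono conjI)
    fix z assume z: "z \<in> cube_on Z"
    show "0 \<le> mean {- 1, 1} (\<lambda>\<sigma>. exp (t * (s z * \<sigma>)))"
      by (intro mean_nonneg) auto
    show "mean {- 1, 1} (\<lambda>\<sigma>. exp (t * (s z * \<sigma>))) \<le> exp (t\<^sup>2)"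
      using signsD[OF s z] exp_add_exp_minus_le[OF t01] by (auto simp: mean_def)
  qed
  also have "\<dots> = exp (D * t\<^sup>2)"
    using Z by (simp add: D_def card_cube_on exp_of_nat_mult[symmetric])
  also have "D * t\<^sup>2 = (real m)\<^sup>2 * \<delta> ^ 4 / 2 ^ card Z"
    using D by (simp add: t_def power_divide power_mult_distrib D_def power2_eq_square field_simps eval_nat_numeral)
  finally show ?thesis .
qed

text \<open>\<open>V\<close> are the nodes, \<open>B\<close> the leaves, \<open>A i\<close> the
  candidate parents of leaf \<open>i\<close> and \<open>Z i\<close> its pointers. Candidates and
  pointers are never leaves, so a leaf column enters the likelihood through its own factor only. The
  strict bound on \<open>\<delta>\<close> keeps all densities positive, so that logarithms make
  sense.\<close>

locale leaf_model =
  fixes V B :: "nat set" and A Z :: "nat \<Rightarrow> nat set" and \<delta> :: real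
  assumes finV: "finite V" and BV: "B \<subseteq> V"
    and AV: "\<And>i. i \<in> B \<Longrightarrow> A i \<subseteq> V - B" and A_ne: "\<And>i. i \<in> B \<Longrightarrow> A i \<noteq> {}"
    and ZV: "\<And>i. i \<in> B \<Longrightarrow> Z i \<subseteq> V - B - A i"
    and \<delta>: "0 \<le> \<delta>" "\<delta> < 1"
begin

definition wires :: "nat \<Rightarrow> (nat \<times> ((nat \<Rightarrow> bool) \<Rightarrow> real)) set" where
  "wires i = A i \<times> signs (Z i)"

text \<open>Density relative to the uniform distribution: given the non-leaves, each leaf takes the
  value that makes its edge 1 with probability \<open>(1 + \<delta>) / 2\<close>.\<close>

definition density :: "(nat \<Rightarrow> nat \<times> ((nat \<Rightarrow> bool) \<Rightarrow> real)) \<Rightarrow> (nat \<Rightarrow> bool) \<Rightarrow> real" where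
  "density h x = (\<Prod>i\<in>B. 1 + \<delta> * edge (Z i) (h i) i x)"

text \<open>The contribution of leaf \<open>i\<close> to the likelihood ratio of the mixture against
  the uniform distribution.\<close>

definition lik :: "nat \<Rightarrow> (nat \<Rightarrow> bool) list \<Rightarrow> real" where
  "lik i xs = mean (wires i) (\<lambda>p. \<Prod>x\<leftarrow>xs. 1 + \<delta> * edge (Z i) p i x)"

lemma finB: "finite B"
  using finV BV by (rule rev_finite_subset)

lemma finZ: "i \<in> B \<Longrightarrow> finite (Z i)"
  using finV ZV[of i] by (meson Diff_subset finite_subset)

lemma finA: "i \<in> B \<Longrightarrow> finite (A i)"
  using finV AV[of i] by (meson Diff_subset finite_subset)

lemma finite_wires: "i \<in> B \<Longrightarrow> finite (wires i)"
  by (simp add: wires_def finZ finA)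

lemma wires_nonempty: "i \<in> B \<Longrightarrow> wires i \<noteq> {}"
  using A_ne by (simp add: wires_def)

lemma wiresD:
  assumes "i \<in> B" "p \<in> wires i"
  shows "fst p \<in> A i" "fst p \<in> V" "fst p \<notin> B" "fst p \<notin> Z i" "snd p \<in> signs (Z i)"
  using assms AV[of i] ZV[of i] by (auto simp: wires_def)

lemma edge_leaf:
  assumes "i \<in> B" "p \<in> wires i"
  shows "edge (Z i) p i (x(i := True)) = - edge (Z i) p i (x(i := False))"
  using wiresD[OF assms] assms(1) ZV[of i] by (subst (1 2) edge_upd_self) auto

lemma edge_upd_other:
  assumes "i \<in> B" "p \<in> wires i" "j \<in> B" "j \<noteq> i"
  shows "edge (Z i) p i (x(j := b)) = edge (Z i) p i x"
  using wiresD[OF assms(1,2)] assms ZV[of i]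
  by (intro dependsD[OF depends_edge[of "Z i" "- {j}"]]) auto

lemma factor_pos:
  assumes "i \<in> B" "p \<in> wires i"
  shows "0 < 1 + \<delta> * edge (Z i) p i x"
  using edge_cases[OF wiresD(5)[OF assms], of i x] \<delta> by auto

text \<open>For every single wire the factors are 1 plus a term odd in bit \<open>i\<close>, so
  column \<open>i\<close> integrates out.\<close>

lemma mean_samples_mult_lik:
  assumes i: "i \<in> B" and G: "column_free i G"
  shows "mean (samples m (cube_on V)) (\<lambda>xs. G xs * lik i xs) = mean (samples m (cube_on V)) G"
proof -
  have "mean (samples m (cube_on V)) (\<lambda>xs. G xs * lik i xs)
      = mean (wires i) (\<lambda>p. mean (samples m (cube_on V))
          (\<lambda>xs. G xs * (\<Prod>x\<leftarrow>xs. 1 + \<delta> * edge (Z i) p i x)))"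
    unfolding lik_def mean_cmult[symmetric] by (rule mean_swap)
  also have "\<dots> = mean (wires i) (\<lambda>p. mean (samples m (cube_on V)) G)"
    using i BV edge_leaf[OF i] by (intro mean_cong mean_samples_leaf[OF _ G]) auto
  also have "\<dots> = mean (samples m (cube_on V)) G"
    using i by (intro mean_const finite_wires wires_nonempty)
  finally show ?thesis .
qed

lemma column_free_lik:
  assumes "i \<in> B" "j \<in> B" "j \<noteq> i"
  shows "column_free j (lik i)"
  unfolding column_free_def lik_def
  using edge_upd_other[OF assms(1) _ assms(2,3)]
  by (auto intro!: mean_cong simp: comp_def)

lemma mean_samples_mult_prod_lik:
  assumes "finite C" "C \<subseteq> B" "\<And>i. i \<in> C \<Longrightarrow> column_free i G"
  shows "mean (samples m (cube_on V)) (\<lambda>xs. G xs * (\<Prod>i\<in>C. lik i xs)) = mean (samples m (cube_on V)) G"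
  using assms
proof (induction C rule: finite_induct)
  case empty
  then show ?case by simp
next
  case (insert i C)
  have "mean (samples m (cube_on V)) (\<lambda>xs. G xs * (\<Prod>i\<in>insert i C. lik i xs))
      = mean (samples m (cube_on V)) (\<lambda>xs. (G xs * (\<Prod>i\<in>C. lik i xs)) * lik i xs)"
    using insert.hyps by (simp add: mult_ac)
  also have "\<dots> = mean (samples m (cube_on V)) (\<lambda>xs. G xs * (\<Prod>i\<in>C. lik i xs))"
  proof (rule mean_samples_mult_lik)
    show "column_free i (\<lambda>xs. G xs * (\<Prod>i\<in>C. lik i xs))"
      unfolding column_free_def
    proof
      fix xs
      have "lik j (map (\<lambda>x. x(i := False)) xs) = lik j xs" if "j \<in> C" for j
        using column_free_lik[of j i] that insert by (auto simp: column_free_def)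
      moreover have "G (map (\<lambda>x. x(i := False)) xs) = G xs"
        using insert.prems(2) by (auto simp: column_free_def)
      ultimately show "G (map (\<lambda>x. x(i := False)) xs) * (\<Prod>j\<in>C. lik j (map (\<lambda>x. x(i := False)) xs))
          = G xs * (\<Prod>j\<in>C. lik j xs)"
        by simp
    qed
  qed (use insert in auto)
  also have "\<dots> = mean (samples m (cube_on V)) G"
    using insert by auto
  finally show ?case .
qed

lemma mean_samples_lik: "i \<in> B \<Longrightarrow> mean (samples m (cube_on V)) (lik i) = 1"
  using mean_samples_mult_lik[of i "\<lambda>_. 1"] finV
  by (simp add: column_free_def mean_const samples_nonempty)

lemma lik_pos:
  assumes "i \<in> B"
  shows "0 < lik i xs"
proof -
  have "0 < (\<Prod>x\<leftarrow>xs. 1 + \<delta> * edge (Z i) p i x)" if "p \<in> wires i" for p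
    using factor_pos[OF assms that] by (induction xs) auto
  then show ?thesis
    unfolding lik_def mean_def using finite_wires[OF assms] wires_nonempty[OF assms]
    by (intro divide_pos_pos sum_pos) (auto simp: card_gt_0_iff)
qed

text \<open>The wires of distinct leaves are chosen independently, so the product of averages is an
  average of products. This identifies the product with the likelihood ratio of the mixture.\<close>

lemma prod_lik_eq:
  "(\<Prod>i\<in>B. lik i xs) = mean (PiE B wires) (\<lambda>h. \<Prod>x\<leftarrow>xs. density h x)"
proof -
  have "(\<Prod>x\<leftarrow>xs. density h x) = (\<Prod>i\<in>B. \<Prod>x\<leftarrow>xs. 1 + \<delta> * edge (Z i) (h i) i x)" for h
    by (induction xs) (auto simp: density_def prod.distrib)
  then show ?thesis
    unfolding lik_def
    using mean_PiE_prod[of B wires "\<lambda>i p. \<Prod>x\<leftarrow>xs. 1 + \<delta> * edge (Z i) p i x"] finB finite_wires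
    by simp
qed

text \<open>The linear terms are odd in bit \<open>i\<close> and cancel; in the product of the two
  edges bit \<open>i\<close> occurs twice and disappears. If the candidates differ, the rest is odd
  in the bit \<open>fst p\<close>; if they agree, the candidate bit disappears too and the
  correlation of the sign functions remains.\<close>

lemma mean_edge_mult_edge:
  assumes i: "i \<in> B" and p: "p \<in> wires i" and q: "q \<in> wires i"
  shows "mean (cube_on V) (\<lambda>x. (1 + \<delta> * edge (Z i) p i x) * (1 + \<delta> * edge (Z i) q i x))
    = (if fst p = fst q then 1 + \<delta>\<^sup>2 * mean (cube_on (Z i)) (\<lambda>z. snd p z * snd q z) else 1)"
proof -
  let ?c = "\<lambda>x. (snd p (restr (Z i) x) * snd q (restr (Z i) x)) * (chi (x (fst p)) * chi (x (fst q)))"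
  have iZ: "i \<notin> Z i" and pi: "fst p \<noteq> i" "fst q \<noteq> i"
    using i ZV[of i] wiresD[OF i p] wiresD[OF i q] by auto
  have iV: "i \<in> V" using i BV by auto
  have ZV': "Z i \<subseteq> V" using ZV[OF i] by auto
  have "mean (cube_on V) (\<lambda>x. (1 + \<delta> * edge (Z i) p i x) * (1 + \<delta> * edge (Z i) q i x))
      = mean (cube_on V) (\<lambda>x. 1 + \<delta>\<^sup>2 * ?c x)"
    by (subst mean_resample[OF iV], rule mean_cong)
       (simp add: edge_upd_self[OF iZ pi(1)] edge_upd_self[OF iZ pi(2)] power2_eq_square algebra_simps)
  also have "\<dots> = 1 + \<delta>\<^sup>2 * mean (cube_on V) ?c"
    using finV by (simp add: mean_add mean_cmult mean_const)
  also have "mean (cube_on V) ?c = (if fst p = fst q then mean (cube_on (Z i)) (\<lambda>z. snd p z * snd q z) else 0)"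
  proof (cases "fst p = fst q")
    case True
    then have "mean (cube_on V) ?c = mean (cube_on V) (\<lambda>x. (\<lambda>z. snd p z * snd q z) (restr (Z i) x))"
      by simp
    also have "\<dots> = mean (cube_on (Z i)) (\<lambda>z. snd p z * snd q z)"
      using finV ZV' by (rule mean_restr)
    finally show ?thesis using True by simp
  next
    case False
    have "restr (Z i) (x(fst p := b)) = restr (Z i) x" for x b
      using wiresD(4)[OF i p] by (auto simp: restr_def)
    then have "mean (cube_on V) ?c = mean (cube_on V) (\<lambda>x. 0)"
      using False wiresD(2)[OF i p] by (subst mean_resample[of "fst p"]) auto
    with False show ?thesis by (simp add: mean_def)
  qed
  finally show ?thesis by simp
qed

text \<open>The second moment is an average over two independent wires. Their candidates agree with
  probability \<open>1 / card (A i)\<close>, and only then does the bound for random signs enter;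
  otherwise the inner mean is 1.\<close>

lemma mean_lik_square_le:
  assumes i: "i \<in> B" and t: "real m * \<delta>\<^sup>2 \<le> 2 ^ card (Z i)"
  shows "mean (samples m (cube_on V)) (\<lambda>xs. (lik i xs)\<^sup>2)
    \<le> 1 + (exp ((real m)\<^sup>2 * \<delta> ^ 4 / 2 ^ card (Z i)) - 1) / card (A i)"
proof -
  define E where "E = exp ((real m)\<^sup>2 * \<delta> ^ 4 / 2 ^ card (Z i))"
  define X where "X s s' = (1 + \<delta>\<^sup>2 * mean (cube_on (Z i)) (\<lambda>z. s z * s' z)) ^ m" for s s' :: "(nat \<Rightarrow> bool) \<Rightarrow> real"
  let ?w = "\<lambda>p xs. \<Prod>x\<leftarrow>xs. 1 + \<delta> * edge (Z i) p i x"
  have A0: "finite (A i)" "A i \<noteq> {}" "card (A i) > 0"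
    using finA[OF i] A_ne[OF i] by (auto simp: card_gt_0_iff)
  have prod2: "?w p xs * ?w q xs = (\<Prod>x\<leftarrow>xs. (1 + \<delta> * edge (Z i) p i x) * (1 + \<delta> * edge (Z i) q i x))" for p q xs
    by (induction xs) (auto simp: algebra_simps)
  have "mean (samples m (cube_on V)) (\<lambda>xs. (lik i xs)\<^sup>2)
      = mean (samples m (cube_on V)) (\<lambda>xs. mean (wires i) (\<lambda>p. mean (wires i) (\<lambda>q. ?w p xs * ?w q xs)))"
    by (simp add: lik_def power2_eq_square mean_cmult mean_multc)
  also have "\<dots> = mean (wires i) (\<lambda>p. mean (wires i) (\<lambda>q. mean (samples m (cube_on V)) (\<lambda>xs. ?w p xs * ?w q xs)))"
    by (subst mean_swap) (intro mean_cong mean_swap)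
  also have "\<dots> = mean (wires i) (\<lambda>p. mean (wires i) (\<lambda>q. if fst p = fst q then X (snd p) (snd q) else 1))"
    unfolding prod2 mean_samples_prod_list
    by (intro mean_cong) (auto simp: mean_edge_mult_edge[OF i] X_def)
  also have "\<dots> \<le> mean (wires i) (\<lambda>p. 1 + (E - 1) / card (A i))"
  proof (rule mean_mono)
    fix p assume p: "p \<in> wires i"
    have j: "fst p \<in> A i" and s: "snd p \<in> signs (Z i)" using wiresD[OF i p] by auto
    have "mean (wires i) (\<lambda>q. if fst p = fst q then X (snd p) (snd q) else 1)
        = mean (A i) (\<lambda>j. if fst p = j then mean (signs (Z i)) (X (snd p)) else 1)"
      using finZ[OF i] by (auto simp: wires_def mean_Times mean_const intro!: mean_cong)
    also have "\<dots> \<le> mean (A i) (\<lambda>j. if fst p = j then E else 1)"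
      using mean_signs_power_le[OF finZ[OF i] s _ t] \<delta> by (intro mean_mono) (auto simp: X_def[abs_def] E_def)
    also have "\<dots> = mean (A i) (\<lambda>j. 1 + (if fst p = j then E - 1 else 0))"
      by (intro mean_cong) auto
    also have "\<dots> = 1 + (E - 1) / card (A i)"
      using A0 j by (simp add: mean_add mean_const) (simp add: mean_def)
    finally show "mean (wires i) (\<lambda>q. if fst p = fst q then X (snd p) (snd q) else 1) \<le> 1 + (E - 1) / card (A i)" .
  qed
  also have "\<dots> = 1 + (E - 1) / card (A i)"
    using i by (intro mean_const finite_wires wires_nonempty)
  finally show ?thesis by (simp add: E_def)
qed

text \<open>Chain rule for relative entropy: \<open>ln\<close> turns the product into a sum, and in
  the term of leaf \<open>i\<close> all other likelihood factors integrate out. Thus the bounds add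
  up over the leaves instead of multiplying.\<close>

lemma mean_abs_lik_diff_le:
  assumes N: "\<And>i. i \<in> B \<Longrightarrow> card (A i) = N" and k: "\<And>i. i \<in> B \<Longrightarrow> card (Z i) = k"
    and t: "real m * \<delta>\<^sup>2 \<le> 2 ^ k"
  shows "(mean (samples m (cube_on V)) (\<lambda>xs. \<bar>(\<Prod>i\<in>B. lik i xs) - 1\<bar>))\<^sup>2
    \<le> 4 * (card B / N * (exp ((real m)\<^sup>2 * \<delta> ^ 4 / 2 ^ k) - 1))"
proof -
  let ?M = "mean (samples m (cube_on V)) :: _ \<Rightarrow> real"
  let ?L = "\<lambda>xs. \<Prod>i\<in>B. lik i xs"
  have one: "?M (\<lambda>xs. 1) = 1"
    using finV by (simp add: mean_const samples_nonempty)
  have "?M ?L = 1"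
    using mean_samples_mult_prod_lik[of B "\<lambda>_. 1"] finB one by (simp add: column_free_def)
  then have "(?M (\<lambda>xs. \<bar>?L xs - 1\<bar>))\<^sup>2 \<le> 4 * ?M (\<lambda>xs. ?L xs * ln (?L xs))"
    using finV lik_pos
    by (intro mean_abs_diff_one_le_relative_entropy) (auto simp: samples_nonempty intro!: prod_pos)
  also have "?M (\<lambda>xs. ?L xs * ln (?L xs)) = ?M (\<lambda>xs. \<Sum>i\<in>B. ?L xs * ln (lik i xs))"
    using lik_pos finB by (simp add: ln_prod sum_distrib_left less_imp_neq[symmetric])
  also have "\<dots> = (\<Sum>i\<in>B. ?M (\<lambda>xs. ?L xs * ln (lik i xs)))"
    by (rule mean_sum)
  also have "\<dots> \<le> (\<Sum>i\<in>B. (exp ((real m)\<^sup>2 * \<delta> ^ 4 / 2 ^ k) - 1) / N)"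
  proof (rule sum_mono)
    fix i assume i: "i \<in> B"
    have "?M (\<lambda>xs. ?L xs * ln (lik i xs))
        = ?M (\<lambda>xs. (lik i xs * ln (lik i xs)) * (\<Prod>j\<in>B - {i}. lik j xs))"
      using i finB by (simp add: prod.remove mult_ac)
    also have "\<dots> = ?M (\<lambda>xs. lik i xs * ln (lik i xs))"
      using finB column_free_lik[OF i]
      by (intro mean_samples_mult_prod_lik) (auto simp: column_free_def)
    \<comment> \<open>From relative entropy to chi-square divergence, leaf by leaf.\<close>
    also have "\<dots> \<le> ?M (\<lambda>xs. (lik i xs)\<^sup>2 - lik i xs)"
    proof (rule mean_mono)
      fix xs
      have "lik i xs * ln (lik i xs) \<le> lik i xs * (lik i xs - 1)"
        using lik_pos[OF i, of xs] by (intro mult_left_mono ln_le_minus_one) auto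
      then show "lik i xs * ln (lik i xs) \<le> (lik i xs)\<^sup>2 - lik i xs"
        by (simp add: power2_eq_square algebra_simps)
    qed
    also have "\<dots> = ?M (\<lambda>xs. (lik i xs)\<^sup>2) - 1"
      using mean_samples_lik[OF i] by (simp add: mean_diff)
    also have "\<dots> \<le> (exp ((real m)\<^sup>2 * \<delta> ^ 4 / 2 ^ k) - 1) / N"
      using mean_lik_square_le[OF i, of m] t N[OF i] k[OF i] by simp
    finally show "?M (\<lambda>xs. ?L xs * ln (lik i xs)) \<le> (exp ((real m)\<^sup>2 * \<delta> ^ 4 / 2 ^ k) - 1) / N" .
  qed
  finally show ?thesis by (simp add: mult_ac)
qed

end

section \<open>Distributions with a density on the cube\<close>

lemma finite_cube [simp]: "finite (cube n)" and card_cube: "card (cube n) = 2 ^ n"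
  by (simp_all add: cube_eq_cube_on card_cube_on)

definition has_density :: "nat \<Rightarrow> (nat \<Rightarrow> bool) pmf \<Rightarrow> ((nat \<Rightarrow> bool) \<Rightarrow> real) \<Rightarrow> bool" where
  "has_density n P p \<longleftrightarrow> dist_on_cube n P \<and> (\<forall>x\<in>cube n. pmf P x = p x / 2 ^ n)"

lemma ex_has_density:
  assumes nonneg: "\<And>x. 0 \<le> p x" and one: "mean (cube n) p = 1"
  shows "\<exists>P. has_density n P p"
proof -
  define f where "f x = (if x \<in> cube n then p x / 2 ^ n else 0)" for x
  have f0: "\<And>x. 0 \<le> f x" by (simp add: f_def nonneg)
  have "(\<integral>\<^sup>+x. ennreal (f x) \<partial>count_space UNIV) = (\<Sum>x\<in>cube n. ennreal (f x))"
    by (rule nn_integral_count_space'[OF finite_cube]) (auto simp: f_def)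
  also have "\<dots> = ennreal (\<Sum>x\<in>cube n. f x)"
    by (rule sum_ennreal[OF f0])
  also have "(\<Sum>x\<in>cube n. f x) = 1"
    using one by (simp add: f_def mean_def card_cube sum_divide_distrib)
  finally have pmf: "pmf (embed_pmf f) x = f x" for x
    using f0 by (simp add: pmf_embed_pmf)
  then have "has_density n (embed_pmf f) p"
    by (auto simp: has_density_def dist_on_cube_def set_pmf_eq f_def)
  then show ?thesis ..
qed

lemma expectation_has_density:
  fixes f :: "(nat \<Rightarrow> bool) \<Rightarrow> real"
  assumes "has_density n P p"
  shows "measure_pmf.expectation P f = mean (cube n) (\<lambda>x. p x * f x)"
proof -
  have "measure_pmf.expectation P f = (\<Sum>x\<in>cube n. f x * pmf P x)"
    using assms by (intro integral_measure_pmf_real) (auto simp: has_density_def dist_on_cube_def)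
  also have "\<dots> = (\<Sum>x\<in>cube n. p x * f x / 2 ^ n)"
    using assms by (intro sum.cong) (auto simp: has_density_def)
  finally show ?thesis by (simp add: mean_def card_cube sum_divide_distrib)
qed

lemma prob_has_density:
  assumes "has_density n P p"
  shows "measure_pmf.prob P {x. E x} = mean (cube n) (\<lambda>x. of_bool (E x) * p x)"
  using expectation_has_density[OF assms, of "indicator {x. E x}"]
  by (simp add: indicator_def of_bool_def mult.commute)

lemma d_TV_has_density:
  assumes "has_density n P p" "has_density n Q q"
  shows "d_TV n P Q = mean (cube n) (\<lambda>x. \<bar>p x - q x\<bar>) / 2"
  using assms by (simp add: d_TV_def has_density_def mean_def card_cube
    diff_divide_distrib[symmetric] sum_divide_distrib)

text \<open>The algorithm is generalized in the induction: once the first sample is drawn, an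
  algorithm on the remaining samples is left.\<close>

lemma output_dist_has_density:
  assumes "has_density n P p"
  shows "pmf (output_dist m A P) b
    = mean (samples m (cube n)) (\<lambda>xs. (\<Prod>x\<leftarrow>xs. p x) * pmf (A xs) b)"
proof (induction m arbitrary: A)
  case 0
  then show ?case by (simp add: output_dist_def bind_return_pmf mean_samples_0)
next
  case (Suc m)
  have "output_dist (Suc m) A P = bind_pmf P (\<lambda>x. output_dist m (\<lambda>xs. A (x # xs)) P)"
    by (simp add: output_dist_def bind_assoc_pmf bind_return_pmf)
  then show ?case
    by (simp add: pmf_bind expectation_has_density[OF assms] Suc mean_samples_Suc mean_cmult mult.assoc)
qed

text \<open>\<open>q i b\<close> is twice the marginal probability, that is, a density against a
  fair bit. The product rule for independent events asks for a nonempty index set, hence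
  \<open>n > 0\<close>.\<close>

lemma product_dist_has_density:
  assumes n: "n > 0" and Q: "product_dist n Q"
  shows "\<exists>q. has_density n Q (\<lambda>x. \<Prod>i<n. q i (x i)) \<and> (\<forall>i b. 0 \<le> q i b)
    \<and> (\<forall>i. (q i True + q i False) / 2 = (1 :: real))"
proof -
  define q where "q i b = 2 * measure_pmf.prob Q {y. y i = b}" for i :: nat and b
  have ind: "prob_space.indep_vars (measure_pmf Q) (\<lambda>_. count_space UNIV) (\<lambda>i x. x i) {..<n}"
    and Qn: "dist_on_cube n Q"
    using Q by (auto simp: product_dist_def)
  have sets: "prob_space.indep_sets (measure_pmf Q)
      (\<lambda>i. {(\<lambda>x. x i) -` S \<inter> space (measure_pmf Q) |S. S \<in> sets (count_space UNIV)}) {..<n}"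
    using ind unfolding prob_space.indep_vars_def2[OF prob_space_measure_pmf] by blast
  have "pmf Q x = (\<Prod>i<n. q i (x i)) / 2 ^ n" if x: "x \<in> cube n" for x
  proof -
    \<comment> \<open>The event on the right leaves the bits from \<open>n\<close> on free, so it
      equals \<open>{x}\<close> only within the support of \<open>Q\<close>.\<close>
    have "{x} \<inter> set_pmf Q = (\<Inter>i\<in>{..<n}. {y. y i = x i}) \<inter> set_pmf Q"
    proof (intro equalityI subsetI)
      fix y assume y: "y \<in> (\<Inter>i\<in>{..<n}. {y. y i = x i}) \<inter> set_pmf Q"
      then have "y \<in> cube n" using Qn by (auto simp: dist_on_cube_def)
      then have "y i = x i" for i
        using x y by (cases "i < n") (auto simp: cube_def)
      then have "y = x" by (rule ext)
      then show "y \<in> {x} \<inter> set_pmf Q" using y by simp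
    qed auto
    then have "pmf Q x = measure_pmf.prob Q (\<Inter>i\<in>{..<n}. {y. y i = x i})"
      by (metis (no_types, lifting) measure_Int_set_pmf measure_pmf_single)
    also have "\<dots> = (\<Prod>i<n. measure_pmf.prob Q {y. y i = x i})"
    proof (rule prob_space.indep_setsD[OF prob_space_measure_pmf sets])
      show "\<forall>i\<in>{..<n}. {y. y i = x i}
          \<in> {(\<lambda>x. x i) -` S \<inter> space (measure_pmf Q) |S. S \<in> sets (count_space UNIV)}"
      proof
        fix i
        show "{y. y i = x i}
            \<in> {(\<lambda>x. x i) -` S \<inter> space (measure_pmf Q) |S. S \<in> sets (count_space UNIV)}"
          by (intro CollectI exI[of _ "{x i}"] conjI) auto
      qed
    qed (use n in auto)
    finally show ?thesis by (simp add: q_def prod.distrib)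
  qed
  then have "has_density n Q (\<lambda>x. \<Prod>i<n. q i (x i))"
    using Qn by (auto simp: has_density_def)
  moreover have "(q i True + q i False) / 2 = 1" for i
  proof -
    have "measure_pmf.prob Q {y. y i = False} = 1 - measure_pmf.prob Q {y. y i = True}"
      using measure_pmf.prob_compl[of "{y. y i = True}" Q]
      by (simp add: Compl_eq_Diff_UNIV[symmetric] Collect_neg_eq)
    then show ?thesis by (simp add: q_def)
  qed
  ultimately show ?thesis
    by (intro exI[of _ q]) (auto simp: q_def)
qed

lemma product_dist_uniform:
  assumes "has_density n U (\<lambda>_. 1)"
  shows "product_dist n U"
proof -
  have "U = Pi_pmf {..<n} False (\<lambda>_. bernoulli_pmf (1 / 2))"
  proof (rule pmf_eqI)
    fix x
    show "pmf U x = pmf (Pi_pmf {..<n} False (\<lambda>_. bernoulli_pmf (1 / 2))) x"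
    proof (cases "x \<in> cube n")
      case True
      then have "pmf (Pi_pmf {..<n} False (\<lambda>_. bernoulli_pmf (1 / 2))) x = (\<Prod>i<n. 1 / 2)"
        by (subst pmf_Pi') (auto simp: cube_def intro!: prod.cong split: bool.splits)
      with True assms show ?thesis by (simp add: has_density_def power_one_over)
    next
      case False
      then have "pmf U x = 0"
        using assms by (auto simp: has_density_def dist_on_cube_def pmf_eq_0_set_pmf)
      with False show ?thesis
        by (subst pmf_Pi_outside) (auto simp: cube_def not_less[symmetric])
    qed
  qed
  then show ?thesis
    using assms indep_vars_Pi_pmf[of "{..<n}" False "\<lambda>_. bernoulli_pmf (1 / 2)"]
    by (simp add: product_dist_def has_density_def)
qed

section \<open>The instances are Bayes nets\<close>

lemma mean_of_bool_coordinate: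
  fixes G :: "(nat \<Rightarrow> bool) \<Rightarrow> real"
  assumes "i \<in> V" "depends (- {i}) G"
  shows "mean (cube_on V) (\<lambda>y. G y * of_bool (y i = b)) = mean (cube_on V) G / 2"
proof -
  have "G (y(i := c)) = G y" for y c
    using assms(2) by (rule dependsD) auto
  then have "mean (cube_on V) (\<lambda>y. G y * of_bool (y i = b)) = mean (cube_on V) (\<lambda>y. G y / 2)"
    using assms(1) by (subst mean_resample[of i]) (auto intro!: mean_cong)
  then show ?thesis by (simp add: mean_divide)
qed

context leaf_model
begin

definition parents :: "(nat \<Rightarrow> nat \<times> ((nat \<Rightarrow> bool) \<Rightarrow> real)) \<Rightarrow> nat \<Rightarrow> nat set" where
  "parents h i = (if i \<in> B then insert (fst (h i)) (Z i) else {})"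

lemma density_pos: "h \<in> PiE B wires \<Longrightarrow> 0 < density h x"
  unfolding density_def by (intro prod_pos factor_pos) auto

text \<open>Leaves that \<open>G\<close> does not read integrate out. For \<open>C = B\<close> this
  says that the non-leaf bits are uniform under every density.\<close>

lemma mean_mult_factors:
  fixes G :: "(nat \<Rightarrow> bool) \<Rightarrow> real"
  assumes h: "h \<in> PiE B wires" and C: "C \<subseteq> B" and G: "depends (- C) G"
  shows "mean (cube_on V) (\<lambda>x. G x * (\<Prod>i\<in>C. 1 + \<delta> * edge (Z i) (h i) i x)) = mean (cube_on V) G"
proof -
  have "mean (cube_on V) (\<lambda>x. G x * (\<Prod>i\<in>C. 1 + \<delta> * edge (Z i) (h i) i x))
      = mean (cube_on V) G * (\<Prod>i\<in>C. 1)"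
  proof (rule mean_leaves)
    fix i assume "i \<in> C"
    then have i: "i \<in> B" "h i \<in> wires i" using h C by auto
    have "depends (- (B - {i})) (edge (Z i) (h i) i)"
      using wiresD[OF i] ZV[OF i(1)] i(1) by (intro depends_edge) auto
    then have "depends (- (C - {i})) (edge (Z i) (h i) i)"
      by (rule depends_mono) (use C in auto)
    then show "depends (- (C - {i})) (\<lambda>x. 1 + \<delta> * edge (Z i) (h i) i x)"
      unfolding depends_def by metis
    show "(1 + \<delta> * edge (Z i) (h i) i (x(i := True)) + (1 + \<delta> * edge (Z i) (h i) i (x(i := False)))) / 2 = 1" for x
      using edge_leaf[OF i] by simp
  qed (use C BV G finB rev_finite_subset in auto)
  then show ?thesis by simp
qed

lemma mean_density:
  assumes "h \<in> PiE B wires"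
  shows "mean (cube_on V) (density h) = 1"
  using mean_mult_factors[OF assms order_refl, of "\<lambda>_. 1"] finV
  by (simp add: density_def[abs_def] depends_def mean_const)

text \<open>Parents are never leaves, so the denominator is the same as under the uniform
  distribution. In the numerator the factor of node \<open>i\<close> reads only bits fixed by the
  event, and all other leaves integrate out.\<close>

lemma mean_density_node:
  assumes h: "h \<in> PiE B wires" and i: "i \<in> V" and x: "x \<in> cube_on V"
  shows "mean (cube_on V) (\<lambda>y. of_bool (y i = x i \<and> (\<forall>j\<in>parents h i. y j = x j)) * density h y)
      / mean (cube_on V) (\<lambda>y. of_bool (\<forall>j\<in>parents h i. y j = x j) * density h y)
    = (if i \<in> B then 1 + \<delta> * edge (Z i) (h i) i x else 1) / 2"
proof -
  define G :: "(nat \<Rightarrow> bool) \<Rightarrow> real" where "G y = of_bool (\<forall>j\<in>parents h i. y j = x j)" for y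
  define w where "w = (if i \<in> B then 1 + \<delta> * edge (Z i) (h i) i x else 1)"
  have pa: "parents h i \<subseteq> - B" "i \<notin> parents h i"
    using wiresD[of i "h i"] ZV[of i] PiE_mem[OF h, of i] by (auto simp: parents_def)
  have "depends (parents h i) G"
    by (auto simp: depends_def G_def)
  then have G: "depends (- B) G" "depends (- {i}) G"
    using pa by (auto elim: depends_mono)
  have den: "mean (cube_on V) (\<lambda>y. G y * density h y) = mean (cube_on V) G"
    unfolding density_def by (rule mean_mult_factors[OF h order_refl G(1)])
  have "of_bool (y i = x i \<and> (\<forall>j\<in>parents h i. y j = x j)) * density h y
      = w * ((G y * of_bool (y i = x i)) * (\<Prod>j\<in>B - {i}. 1 + \<delta> * edge (Z j) (h j) j y))" for y
  proof (cases "y i = x i \<and> (\<forall>j\<in>parents h i. y j = x j)")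
    case True
    show ?thesis
    proof (cases "i \<in> B")
      case iB: True
      have "restr (Z i) y = restr (Z i) x"
        using True iB by (auto simp: restr_def parents_def)
      then have "edge (Z i) (h i) i y = edge (Z i) (h i) i x"
        using True iB by (simp add: edge_def parents_def)
      then show ?thesis
        using True iB finB by (simp add: density_def w_def G_def prod.remove)
    next
      case False
      then show ?thesis using True by (simp add: density_def w_def G_def)
    qed
  next
    case False
    then show ?thesis by (auto simp: G_def)
  qed
  then have "mean (cube_on V) (\<lambda>y. of_bool (y i = x i \<and> (\<forall>j\<in>parents h i. y j = x j)) * density h y)
      = w * mean (cube_on V) (\<lambda>y. (G y * of_bool (y i = x i)) * (\<Prod>j\<in>B - {i}. 1 + \<delta> * edge (Z j) (h j) j y))"
    by (simp only: mean_cmult)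
  also have "mean (cube_on V) (\<lambda>y. (G y * of_bool (y i = x i)) * (\<Prod>j\<in>B - {i}. 1 + \<delta> * edge (Z j) (h j) j y))
      = mean (cube_on V) (\<lambda>y. G y * of_bool (y i = x i))"
  proof (rule mean_mult_factors[OF h])
    have "depends (- (B - {i})) G" using G(1) by (rule depends_mono) auto
    moreover have "depends (- (B - {i})) (\<lambda>y. of_bool (y i = x i) :: real)"
      by (auto simp: depends_def)
    ultimately show "depends (- (B - {i})) (\<lambda>y. G y * of_bool (y i = x i))"
      by (rule depends_mult)
  qed auto
  also have "\<dots> = mean (cube_on V) G / 2"
    by (rule mean_of_bool_coordinate[OF i G(2)])
  finally have num: "mean (cube_on V) (\<lambda>y. of_bool (y i = x i \<and> (\<forall>j\<in>parents h i. y j = x j)) * density h y)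
      = w * (mean (cube_on V) G / 2)" .
  \<comment> \<open>The point \<open>x\<close> itself satisfies the conditioning event, so the
    quotient is not a division by \<open>0\<close>.\<close>
  have "0 < (\<Sum>y\<in>cube_on V. G y)"
    using x finV by (intro sum_pos2[of _ x]) (auto simp: G_def)
  then have "0 < mean (cube_on V) G"
    using finV by (simp add: mean_def card_cube_on)
  then show ?thesis
    unfolding num using den by (simp add: G_def w_def)
qed

end

lemma (in leaf_model) bayes_net_has_density:
  assumes V: "V = {..<n}" and h: "h \<in> PiE B wires" and P: "has_density n P (density h)"
    and d: "\<And>i. i \<in> B \<Longrightarrow> card (Z i) < d"
  shows "bayes_net n d P"
  unfolding bayes_net_def
proof (intro conjI exI)
  show "dist_on_cube n P" using P by (simp add: has_density_def)
  show "parent_dag n d (parents h)"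
    unfolding parent_dag_def
  proof (intro conjI allI impI)
    fix i assume "i < n"
    show "parents h i \<subseteq> {..<n}"
      using PiE_mem[OF h, of i] wiresD[of i "h i"] ZV[of i] V by (auto simp: parents_def)
    show "card (parents h i) \<le> d"
      using d[of i] finZ[of i] by (auto simp: parents_def card_insert_if)
  next
    show "acyclic {(j, i). i < n \<and> j \<in> parents h i}"
    \<comment> \<open>All arrows lead from non-leaves to leaves; the rank is 1 on the former and 0
      on the latter.\<close>
    proof (rule acyclicI_order)
      fix j i assume "(j, i) \<in> {(j, i). i < n \<and> j \<in> parents h i}"
      then have "i \<in> B" "j \<notin> B"
        using PiE_mem[OF h, of i] wiresD[of i "h i"] ZV[of i] by (auto simp: parents_def split: if_splits)
      then show "of_bool (i \<notin> B) < (of_bool (j \<notin> B) :: nat)" by simp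
    qed
  qed
  show "\<forall>x\<in>cube n. pmf P x
      = (\<Prod>i<n. cond_prob (measure_pmf P) (\<lambda>y. y i = x i) (\<lambda>y. \<forall>j\<in>parents h i. y j = x j))"
  proof
    fix x assume x: "x \<in> cube n"
    have node: "cond_prob (measure_pmf P) (\<lambda>y. y i = x i) (\<lambda>y. \<forall>j\<in>parents h i. y j = x j)
        = (if i \<in> B then 1 + \<delta> * edge (Z i) (h i) i x else 1) / 2" if "i < n" for i
      using mean_density_node[OF h, of i x] that x V
      by (simp add: cond_prob_def prob_has_density[OF P] cube_eq_cube_on)
    have "(\<Prod>i<n. cond_prob (measure_pmf P) (\<lambda>y. y i = x i) (\<lambda>y. \<forall>j\<in>parents h i. y j = x j))
        = (\<Prod>i<n. (if i \<in> B then 1 + \<delta> * edge (Z i) (h i) i x else 1) / 2)"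
      by (intro prod.cong refl node) simp
    also have "\<dots> = (\<Prod>i<n. if i \<in> B then 1 + \<delta> * edge (Z i) (h i) i x else 1) / 2 ^ n"
      by (simp add: prod_dividef)
    also have "(\<Prod>i<n. if i \<in> B then 1 + \<delta> * edge (Z i) (h i) i x else 1) = density h x"
      using BV V by (simp add: density_def prod.If_cases Int_absorb1 prod.neutral)
    finally show "pmf P x
        = (\<Prod>i<n. cond_prob (measure_pmf P) (\<lambda>y. y i = x i) (\<lambda>y. \<forall>j\<in>parents h i. y j = x j))"
      using P x by (simp add: has_density_def)
  qed
qed

text \<open>In the leaf model without leaves every density is an empty product.\<close>

lemma bayes_net_uniform:
  assumes U: "has_density n U (\<lambda>_. 1)"
  shows "bayes_net n d U"
proof -
  interpret leaf_model "{..<n}" "{}" "\<lambda>_. {}" "\<lambda>_. {}" 0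
    by unfold_locales auto
  show ?thesis
    using U by (intro bayes_net_has_density[of n "\<lambda>_. undefined"]) (auto simp: density_def[abs_def])
qed

section \<open>Distance from product distributions\<close>

text \<open>Multiplication by \<open>Complex 1 \<tau>\<close> lowers the real part by at most
  \<open>N * \<tau>\<^sup>2\<close>, so in \<open>N\<close> steps it stays between 3/4 and 1. Hence
  every step adds at least \<open>3 / 4 * \<tau>\<close> to the imaginary part. The upper bound on
  the imaginary part is carried along to control the real one.\<close>

lemma Im_power_ge:
  assumes \<tau>: "0 \<le> \<tau>" and N: "real N * \<tau> \<le> 1 / 2"
  shows "3 / 4 * (real N * \<tau>) \<le> Im (Complex 1 \<tau> ^ N)"
proof -
  have N2: "(real N * \<tau>)\<^sup>2 \<le> 1 / 4"
    using power_mono[OF N, of 2] \<tau> by (simp add: power_divide)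
  have "1 - real k * (real N * \<tau>\<^sup>2) \<le> Re (Complex 1 \<tau> ^ k) \<and> Re (Complex 1 \<tau> ^ k) \<le> 1
      \<and> 3 / 4 * (real k * \<tau>) \<le> Im (Complex 1 \<tau> ^ k) \<and> Im (Complex 1 \<tau> ^ k) \<le> real k * \<tau>"
    if "k \<le> N" for k
    using that
  proof (induction k)
    case 0
    then show ?case by simp
  next
    case (Suc k)
    define a b where "a = Re (Complex 1 \<tau> ^ k)" and "b = Im (Complex 1 \<tau> ^ k)"
    have IH: "1 - real k * (real N * \<tau>\<^sup>2) \<le> a" "a \<le> 1" "3 / 4 * (real k * \<tau>) \<le> b" "b \<le> real k * \<tau>"
      using Suc by (auto simp: a_def b_def)
    have "0 \<le> real k * \<tau>" using \<tau> by simp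
    then have "0 \<le> b" using IH(3) by linarith
    then have b0: "0 \<le> \<tau> * b" using \<tau> by simp
    have "real k * (real N * \<tau>\<^sup>2) \<le> real N * (real N * \<tau>\<^sup>2)"
      using Suc.prems by (intro mult_right_mono) auto
    also have "\<dots> \<le> 1 / 4" using N2 by (simp add: power2_eq_square mult_ac)
    finally have a34: "3 / 4 \<le> a" using IH(1) by linarith
    have "\<tau> * b \<le> \<tau> * (real k * \<tau>)" using IH(4) \<tau> by (rule mult_left_mono)
    also have "\<dots> = real k * \<tau>\<^sup>2" by (simp add: power2_eq_square)
    also have "\<dots> \<le> real N * \<tau>\<^sup>2" using Suc.prems by (intro mult_right_mono) auto
    finally have "1 - real (Suc k) * (real N * \<tau>\<^sup>2) \<le> a - \<tau> * b"
      using IH(1) by (simp add: algebra_simps)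
    moreover have "a - \<tau> * b \<le> 1" using IH(2) b0 by linarith
    moreover have "\<tau> * (3 / 4) \<le> \<tau> * a" "\<tau> * a \<le> \<tau> * 1"
      using \<tau> by (intro mult_left_mono a34 IH(2); simp)+
    then have "3 / 4 * (real (Suc k) * \<tau>) \<le> b + \<tau> * a" "b + \<tau> * a \<le> real (Suc k) * \<tau>"
      using IH(3,4) by (simp_all add: algebra_simps)
    moreover have "Re (Complex 1 \<tau> ^ Suc k) = a - \<tau> * b" "Im (Complex 1 \<tau> ^ Suc k) = b + \<tau> * a"
      by (simp_all add: a_def b_def)
    ultimately show ?case by simp
  qed
  then show ?thesis by blast
qed

lemma Im_mean: "Im (mean S F) = mean S (\<lambda>x. Im (F x))"
  by (simp add: mean_def)

text \<open>With \<open>b\<close> the Bhattacharyya coefficient, the two factors in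
  \<open>mean_abs_diff_sqrt\<close> are \<open>2 - 2 * b\<close> and
  \<open>2 + 2 * b\<close>.\<close>

lemma mean_sqrt_mult_le:
  fixes F G :: "'a \<Rightarrow> real"
  assumes S: "finite S" "S \<noteq> {}" and F: "\<And>x. 0 \<le> F x" "mean S F = 1"
    and G: "\<And>x. 0 \<le> G x" "mean S G = 1"
  shows "mean S (\<lambda>x. sqrt (F x * G x)) \<le> sqrt (1 - (mean S (\<lambda>x. \<bar>F x - G x\<bar>) / 2)\<^sup>2)"
proof (rule real_le_rsqrt)
  define b where "b = mean S (\<lambda>x. sqrt (F x * G x))"
  have "(sqrt (F x) - sqrt (G x))\<^sup>2 = F x + G x - 2 * sqrt (F x * G x)"
    "(sqrt (F x) + sqrt (G x))\<^sup>2 = F x + G x + 2 * sqrt (F x * G x)" for x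
    using F(1)[of x] G(1)[of x] by (simp_all add: power2_diff power2_sum real_sqrt_mult)
  then have "(mean S (\<lambda>x. \<bar>F x - G x\<bar>))\<^sup>2 \<le> (2 - 2 * b) * (2 + 2 * b)"
    using mean_abs_diff_sqrt[of S F G] F G
    by (simp add: mean_add mean_diff mean_cmult b_def)
  also have "\<dots> = 4 - 4 * b\<^sup>2" by (simp add: algebra_simps power2_eq_square)
  finally show "b\<^sup>2 \<le> 1 - (mean S (\<lambda>x. \<bar>F x - G x\<bar>) / 2)\<^sup>2"
    by (simp add: power_divide)
qed

lemma depends_prod_coordinates: "C \<subseteq> W \<Longrightarrow> depends W (\<lambda>x. \<Prod>i\<in>C. q i (x i))"
  unfolding depends_def by (auto intro!: prod.cong)

lemma mean_prod_coordinates: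
  fixes q :: "nat \<Rightarrow> bool \<Rightarrow> real"
  assumes "finite V" "C \<subseteq> V" and q: "\<And>i. (q i True + q i False) / 2 = 1"
  shows "mean (cube_on V) (\<lambda>x. \<Prod>i\<in>C. q i (x i)) = 1"
proof -
  have "finite C" using assms(1,2) by (rule rev_finite_subset)
  then have "mean (cube_on V) (\<lambda>x. 1 * (\<Prod>i\<in>C. q i (x i))) = mean (cube_on V) (\<lambda>x. 1) * (\<Prod>i\<in>C. 1)"
    using assms by (intro mean_leaves) (auto simp: depends_def)
  then show ?thesis using assms by (simp add: mean_const)
qed

section \<open>A bounded odd statistic of the edges\<close>

context leaf_model
begin

text \<open>The normalized sum of the edges would be the natural statistic, but it can be as large
  as \<open>sqrt (card C)\<close>. The imaginary part of this product is a bounded replacement,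
  still odd in the edges, and the product factorizes over the leaves.\<close>

definition phase :: "nat set \<Rightarrow> (nat \<Rightarrow> nat \<times> ((nat \<Rightarrow> bool) \<Rightarrow> real)) \<Rightarrow> (nat \<Rightarrow> bool) \<Rightarrow> complex" where
  "phase C h x = (\<Prod>i\<in>C. Complex 1 (edge (Z i) (h i) i x / sqrt (card C)))"

text \<open>Each factor has modulus \<open>sqrt (1 + 1 / card C)\<close>, so the squared modulus of
  the product is at most \<open>exp 1\<close>, which is below 4.\<close>

lemma norm_phase:
  assumes "C \<subseteq> B" "h \<in> PiE B wires"
  shows "norm (phase C h x) \<le> 2"
proof -
  define N where "N = card C"
  have fin: "finite C" using assms(1) finB by (rule finite_subset)
  have "norm (Complex 1 (edge (Z i) (h i) i x / sqrt N)) = sqrt (1 + 1 / N)" if "i \<in> C" for i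
  proof -
    have i: "i \<in> B" "h i \<in> wires i" using that assms by auto
    show ?thesis
      using edge_cases[OF wiresD(5)[OF i], of i x] by (auto simp: cmod_def power_divide)
  qed
  then have "norm (phase C h x) = (\<Prod>i\<in>C. sqrt (1 + 1 / N))"
    by (simp add: phase_def prod_norm[symmetric] N_def)
  also have "\<dots> = sqrt ((1 + 1 / N) ^ N)"
    by (simp add: N_def real_sqrt_power)
  also have "(1 + 1 / N) ^ N \<le> exp (1 / N) ^ N"
    by (intro power_mono exp_ge_add_one_self) auto
  also have "\<dots> \<le> exp 1"
    by (cases "N = 0") (auto simp: exp_of_nat_mult[symmetric])
  also have "\<dots> \<le> 2\<^sup>2" using exp_le by simp
  finally show ?thesis by simp
qed

text \<open>The average of \<open>Complex 1 (e / sqrt N)\<close> with weights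
  \<open>1 + \<delta> * e\<close> over the two signs \<open>e\<close> is
  \<open>Complex 1 (\<delta> / sqrt N)\<close>. Leaves outside \<open>C\<close> contribute
  1.\<close>

lemma mean_density_phase:
  assumes "C \<subseteq> B" "h \<in> PiE B wires"
  shows "mean (cube_on V) (\<lambda>x. density h x * Im (phase C h x)) = Im (Complex 1 (\<delta> / sqrt (card C)) ^ card C)"
proof -
  define N where "N = card C"
  define g where "g i x = of_real (1 + \<delta> * edge (Z i) (h i) i x)
    * (if i \<in> C then Complex 1 (edge (Z i) (h i) i x / sqrt N) else 1)" for i x
  have g: "of_real (density h x) * phase C h x = (\<Prod>i\<in>B. g i x)" for x
    using assms(1) finB
    by (simp add: density_def phase_def g_def prod.distrib N_def prod.If_cases Int_absorb1)
  have "mean (cube_on V) (\<lambda>x. 1 * (\<Prod>i\<in>B. g i x))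
      = mean (cube_on V) (\<lambda>x. 1) * (\<Prod>i\<in>B. if i \<in> C then Complex 1 (\<delta> / sqrt N) else 1)"
  proof (rule mean_leaves)
    fix i assume i: "i \<in> B"
    then have hi: "h i \<in> wires i" using assms(2) by auto
    have "depends (- (B - {i})) (edge (Z i) (h i) i)"
      using wiresD[OF i hi] ZV[OF i] i by (intro depends_edge) auto
    then show "depends (- (B - {i})) (g i)"
      unfolding g_def
      by (rule depends_comp[where f = "\<lambda>t. of_real (1 + \<delta> * t) * (if i \<in> C then Complex 1 (t / sqrt N) else 1)"])
    show "(g i (x(i := True)) + g i (x(i := False))) / 2 = (if i \<in> C then Complex 1 (\<delta> / sqrt N) else 1)" for x
      using edge_cases[OF wiresD(5)[OF i hi], of i "x(i := False)"]
      by (auto simp: g_def edge_leaf[OF i hi] complex_eq_iff diff_divide_distrib[symmetric])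
  qed (use finB BV in \<open>auto simp: depends_def\<close>)
  also have "\<dots> = Complex 1 (\<delta> / sqrt N) ^ N"
    using assms(1) finB finV by (simp add: mean_const prod.If_cases Int_absorb1 N_def)
  finally have "mean (cube_on V) (\<lambda>x. of_real (density h x) * phase C h x) = Complex 1 (\<delta> / sqrt N) ^ N"
    by (simp add: g)
  from arg_cong[OF this, of Im] show ?thesis
    by (simp add: Im_mean N_def)
qed

text \<open>Every edge of \<open>C\<close> contains exactly one bit from \<open>A0\<close>, its
  candidate, so the flip negates all these edges.\<close>

lemma phase_flip:
  assumes "C \<subseteq> B" "h \<in> PiE B wires" "A0 \<inter> B = {}"
    and "\<And>i. i \<in> C \<Longrightarrow> fst (h i) \<in> A0 \<and> Z i \<inter> A0 = {}"
  shows "phase C h (flip A0 x) = cnj (phase C h x)"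
proof -
  have "edge (Z i) (h i) i (flip A0 x) = - edge (Z i) (h i) i x" if i: "i \<in> C" for i
  proof -
    have "restr (Z i) (flip A0 x) = restr (Z i) x"
      using assms(4)[OF i] by (auto simp: restr_def flip_def)
    then show ?thesis
      using assms i by (auto simp: edge_def flip_def)
  qed
  moreover have "cnj (Complex 1 a) = Complex 1 (- a)" for a
    by (simp add: complex_eq_iff)
  ultimately show ?thesis
    by (simp add: phase_def)
qed

text \<open>Under a product distribution the bits in \<open>A0\<close> are independent of all others. If they are
  fair, the odd statistic \<open>Im (phase C h)\<close> averages to zero; if they are not, their marginal
  alone is as far from the fair one as the correction term is large. Hence the factor \<open>2\<close>.\<close>

lemma mean_density_mult_odd_le:
  assumes h: "h \<in> PiE B wires" and A0: "A0 \<subseteq> V - B" "A0 \<subseteq> D" "D \<subseteq> V"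
    and q: "\<And>i b. 0 \<le> q i b" "\<And>i. (q i True + q i False) / 2 = (1 :: real)"
    and \<Phi>: "\<And>x. \<Phi> (flip A0 x) = - \<Phi> x" "\<And>x. \<bar>\<Phi> x\<bar> \<le> 1"
  shows "mean (cube_on V) (\<lambda>x. density h x * \<Phi> x)
    \<le> 2 * mean (cube_on V) (\<lambda>x. \<bar>density h x - (\<Prod>i\<in>D. q i (x i))\<bar>)"
proof -
  let ?M = "mean (cube_on V) :: _ \<Rightarrow> real"
  define qA where "qA x = (\<Prod>i\<in>A0. q i (x i))" for x
  define qR where "qR x = (\<Prod>i\<in>D - A0. q i (x i))" for x
  define Q where "Q x = (\<Prod>i\<in>D. q i (x i))" for x
  \<comment> \<open>The test that realizes the distance of the marginal \<open>qA\<close> from the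
    fair one. It reads non-leaf bits only, so under the density it has its uniform mean.\<close>
  define \<sigma> where "\<sigma> x = sgn (qA x - 1)" for x
  have finD: "finite D" using A0(3) finV by (rule finite_subset)
  have Q: "Q x = qA x * qR x" for x
    using A0(2) finD by (simp add: Q_def qA_def qR_def prod.subset_diff mult.commute)
  have qR: "depends (- A0) qR" "?M qR = 1" "0 \<le> qR x" for x
    unfolding qR_def[abs_def] using A0 finV q
    by (auto intro!: depends_prod_coordinates mean_prod_coordinates prod_nonneg)
  have qA: "depends A0 qA" unfolding qA_def[abs_def] by (rule depends_prod_coordinates) simp
  then have \<sigma>: "depends A0 \<sigma>" "depends A0 (\<lambda>x. \<sigma> x * qA x)" "depends A0 (\<lambda>x. \<bar>qA x - 1\<bar>)"
    unfolding depends_def \<sigma>_def by metis+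
  have "depends (- B) \<sigma>" using \<sigma>(1) by (rule depends_mono) (use A0 in auto)
  then have \<sigma>P: "?M (\<lambda>x. \<sigma> x * density h x) = ?M \<sigma>"
    unfolding density_def by (rule mean_mult_factors[OF h order_refl])
  have \<sigma>Q: "?M (\<lambda>x. \<sigma> x * Q x) = ?M (\<lambda>x. \<sigma> x * qA x)"
    using mean_indep[OF \<sigma>(2) qR(1), of V] qR(2) by (simp add: Q mult.assoc)
  have "?M (\<lambda>x. \<bar>qA x - 1\<bar>) = ?M (\<lambda>x. \<sigma> x * qA x - \<sigma> x)"
    by (intro mean_cong) (simp add: \<sigma>_def abs_sgn algebra_simps)
  also have "\<dots> = ?M (\<lambda>x. \<sigma> x * Q x - \<sigma> x * density h x)"
    by (simp add: mean_diff \<sigma>P \<sigma>Q)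
  also have "\<dots> \<le> ?M (\<lambda>x. \<bar>density h x - Q x\<bar>)"
  proof (rule mean_mono)
    fix x
    have "\<sigma> x = 0 \<or> \<sigma> x = 1 \<or> \<sigma> x = - 1" by (auto simp: \<sigma>_def sgn_if)
    then show "\<sigma> x * Q x - \<sigma> x * density h x \<le> \<bar>density h x - Q x\<bar>" by auto
  qed
  finally have marg: "?M (\<lambda>x. \<bar>qA x - 1\<bar>) \<le> ?M (\<lambda>x. \<bar>density h x - Q x\<bar>)" .
  have "qR (flip A0 x) = qR x" for x
    using qR(1) by (rule dependsD) (auto simp: flip_def)
  then have "?M (\<lambda>x. qR x * \<Phi> x) = ?M (\<lambda>x. - 1 * (qR x * \<Phi> x))"
    using A0 by (subst mean_flip[of A0]) (auto simp: \<Phi>(1))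
  then have odd: "?M (\<lambda>x. qR x * \<Phi> x) = 0"
    unfolding mean_cmult by simp
  \<comment> \<open>The density is replaced by \<open>Q = qA * qR\<close> and then by
    \<open>qR\<close>. Each replacement costs at most the distance in question, and
    \<open>qR * \<Phi>\<close> is odd under the flip.\<close>
  have "?M (\<lambda>x. density h x * \<Phi> x)
      = ?M (\<lambda>x. (density h x - Q x) * \<Phi> x + (qA x - 1) * qR x * \<Phi> x + qR x * \<Phi> x)"
    by (intro mean_cong) (simp add: Q algebra_simps)
  also have "\<dots> \<le> ?M (\<lambda>x. \<bar>density h x - Q x\<bar> + \<bar>qA x - 1\<bar> * qR x + qR x * \<Phi> x)"
  proof (rule mean_mono)
    fix x
    have le: "c * \<Phi> x \<le> \<bar>c\<bar>" for c
      using mult_left_mono[OF \<Phi>(2), of "\<bar>c\<bar>" x] abs_le_D1[of "c * \<Phi> x" "\<bar>c\<bar>"] by (simp add: abs_mult)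
    have "\<bar>(qA x - 1) * qR x\<bar> = \<bar>qA x - 1\<bar> * qR x"
      using qR(3) by (simp add: abs_mult)
    then show "(density h x - Q x) * \<Phi> x + (qA x - 1) * qR x * \<Phi> x + qR x * \<Phi> x
        \<le> \<bar>density h x - Q x\<bar> + \<bar>qA x - 1\<bar> * qR x + qR x * \<Phi> x"
      using le[of "density h x - Q x"] le[of "(qA x - 1) * qR x"] by linarith
  qed
  also have "\<dots> = ?M (\<lambda>x. \<bar>density h x - Q x\<bar>) + ?M (\<lambda>x. \<bar>qA x - 1\<bar>)"
    using mean_indep[OF \<sigma>(3) qR(1), of V] by (simp add: mean_add odd qR(2))
  finally show ?thesis using marg by (simp add: Q_def)
qed

text \<open>The odd function is \<open>Im (phase C h) / 2\<close>: halving and the factor 2 of the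
  preceding lemma turn 3/4 into 3/16. \<open>D\<close> may be a proper part of \<open>V\<close>, so
  that one block can be treated alone.\<close>

lemma density_far_from_product:
  assumes h: "h \<in> PiE B wires" and C: "C \<subseteq> B" "C \<noteq> {}"
    and A0: "A0 \<subseteq> V - B" "A0 \<subseteq> D" "D \<subseteq> V"
    and CA: "\<And>i. i \<in> C \<Longrightarrow> fst (h i) \<in> A0 \<and> Z i \<inter> A0 = {}"
    and q: "\<And>i b. 0 \<le> q i b" "\<And>i. (q i True + q i False) / 2 = (1 :: real)"
    and \<kappa>: "\<delta> * sqrt (card C) \<le> 1 / 2"
  shows "3 / 16 * (\<delta> * sqrt (card C)) \<le> mean (cube_on V) (\<lambda>x. \<bar>density h x - (\<Prod>i\<in>D. q i (x i))\<bar>)"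
proof -
  define N where "N = card C"
  have N: "N > 0" using C finB by (auto simp: N_def card_gt_0_iff intro: finite_subset)
  have \<kappa>': "real N * (\<delta> / sqrt N) = \<delta> * sqrt N"
    using N by (simp add: field_simps)
  have "3 / 4 * (\<delta> * sqrt N) \<le> Im (Complex 1 (\<delta> / sqrt N) ^ N)"
    using Im_power_ge[of "\<delta> / sqrt N" N, unfolded \<kappa>'] \<delta> \<kappa>[folded N_def] by simp
  also have "\<dots> = 2 * mean (cube_on V) (\<lambda>x. density h x * (Im (phase C h x) / 2))"
    using mean_density_phase[OF C(1) h] by (simp add: N_def mean_divide)
  also have "mean (cube_on V) (\<lambda>x. density h x * (Im (phase C h x) / 2))
      \<le> 2 * mean (cube_on V) (\<lambda>x. \<bar>density h x - (\<Prod>i\<in>D. q i (x i))\<bar>)"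
  proof (rule mean_density_mult_odd_le[OF h A0 q])
    show "Im (phase C h (flip A0 x)) / 2 = - (Im (phase C h x) / 2)" for x
      using A0 by (subst phase_flip[OF C(1) h _ CA]) auto
    show "\<bar>Im (phase C h x) / 2\<bar> \<le> 1" for x
      using norm_phase[OF C(1) h, of x] abs_Im_le_cmod[of "phase C h x"] by simp
  qed
  finally show ?thesis by (simp add: N_def)
qed

end

text \<open>\<open>R\<close> blocks of \<open>N\<close> leaves each; the leaves of block
  \<open>r\<close> share the candidates \<open>A0 r\<close>. Pointers and candidates of a leaf lie
  in its own block, so the blocks are independent under every density. Nodes with \<open>blk\<close>
  at least \<open>R\<close> are padding.\<close>

locale block_model = leaf_model +
  fixes blk :: "nat \<Rightarrow> nat" and A0 :: "nat \<Rightarrow> nat set" and R N :: nat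
  assumes blk_B: "\<And>i. i \<in> B \<Longrightarrow> blk i < R"
    and A_eq: "\<And>i. i \<in> B \<Longrightarrow> A i = A0 (blk i)"
    and blk_A: "\<And>r j. j \<in> A0 r \<Longrightarrow> blk j = r"
    and blk_Z: "\<And>i j. i \<in> B \<Longrightarrow> j \<in> Z i \<Longrightarrow> blk j = blk i"
    and card_B: "\<And>r. r < R \<Longrightarrow> card {i \<in> B. blk i = r} = N"
    and N_pos: "N > 0" and R_pos: "R > 0"
    and \<kappa>: "\<delta> * sqrt N \<le> 1 / 2"
begin

lemma leaves_nonempty: "r < R \<Longrightarrow> {i \<in> B. blk i = r} \<noteq> {}"
  using card_B[of r] N_pos by (metis card.empty less_irrefl)

lemma A0_subset: "r < R \<Longrightarrow> A0 r \<subseteq> V - B"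
  using leaves_nonempty[of r] A_eq AV by blast

lemma leaf_in_block:
  assumes "h \<in> PiE B wires" "i \<in> B" "blk i = r"
  shows "fst (h i) \<in> A0 r \<and> Z i \<inter> A0 r = {}"
  using assms wiresD(1)[of i "h i"] A_eq[of i] ZV[of i] by (auto dest: PiE_mem)

text \<open>Block 0 alone already gives the bound that is linear in \<open>\<delta>\<close>.\<close>

lemma density_far_small:
  assumes h: "h \<in> PiE B wires"
    and q: "\<And>i b. 0 \<le> q i b" "\<And>i. (q i True + q i False) / 2 = (1 :: real)"
  shows "3 / 16 * (\<delta> * sqrt N) \<le> mean (cube_on V) (\<lambda>x. \<bar>density h x - (\<Prod>i\<in>V. q i (x i))\<bar>)"
proof -
  have "3 / 16 * (\<delta> * sqrt (card {i \<in> B. blk i = 0}))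
      \<le> mean (cube_on V) (\<lambda>x. \<bar>density h x - (\<Prod>i\<in>V. q i (x i))\<bar>)"
    using A0_subset[OF R_pos] leaves_nonempty[OF R_pos] leaf_in_block[OF h] \<kappa> card_B[OF R_pos]
    by (intro density_far_from_product[OF h, of _ "A0 0"] q) auto
  then show ?thesis by (simp add: card_B[OF R_pos])
qed

text \<open>One minus the total variation distance is the mean of the minimum of the densities,
  hence at most their Bhattacharyya coefficient. This factorizes over the blocks, each of which is
  far from product by itself, and the padding contributes at most 1.\<close>

lemma density_far_large:
  assumes h: "h \<in> PiE B wires"
    and q: "\<And>i b. 0 \<le> q i b" "\<And>i. (q i True + q i False) / 2 = (1 :: real)"
  shows "1 - sqrt (1 - (3 / 32 * (\<delta> * sqrt N))\<^sup>2) ^ R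
    \<le> mean (cube_on V) (\<lambda>x. \<bar>density h x - (\<Prod>i\<in>V. q i (x i))\<bar>) / 2"
proof -
  let ?M = "mean (cube_on V) :: _ \<Rightarrow> real"
  define Br where "Br r = {i \<in> B. blk i = r}" for r
  define Vr where "Vr r = {i \<in> V. blk i = r}" for r
  define p where "p r x = (\<Prod>i\<in>Br r. 1 + \<delta> * edge (Z i) (h i) i x)" for r x
  define qb where "qb r x = (\<Prod>i\<in>Vr r. q i (x i))" for r x
  define ql where "ql x = (\<Prod>i\<in>{i \<in> V. \<not> blk i < R}. q i (x i))" for x
  define Q where "Q x = (\<Prod>i\<in>V. q i (x i))" for x
  have p_eq: "density h x = (\<Prod>r<R. p r x)" for x
  proof -
    have "density h x = (\<Prod>i\<in>(\<Union>r<R. Br r). 1 + \<delta> * edge (Z i) (h i) i x)"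
      unfolding density_def by (rule prod.cong) (auto simp: Br_def blk_B)
    also have "\<dots> = (\<Prod>r<R. p r x)"
      unfolding p_def using finB by (subst prod.UNION_disjoint) (auto simp: Br_def)
    finally show ?thesis .
  qed
  have Q_eq: "Q x = (\<Prod>r<R. qb r x) * ql x" for x
  proof -
    have "V = (\<Union>r<R. Vr r) \<union> {i \<in> V. \<not> blk i < R}" by (auto simp: Vr_def)
    then have "Q x = (\<Prod>i\<in>(\<Union>r<R. Vr r) \<union> {i \<in> V. \<not> blk i < R}. q i (x i))"
      unfolding Q_def by simp
    also have "\<dots> = (\<Prod>i\<in>(\<Union>r<R. Vr r). q i (x i)) * ql x"
      unfolding ql_def using finV by (subst prod.union_disjoint) (auto simp: Vr_def)
    also have "(\<Prod>i\<in>(\<Union>r<R. Vr r). q i (x i)) = (\<Prod>r<R. qb r x)"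
      unfolding qb_def using finV by (subst prod.UNION_disjoint) (auto simp: Vr_def)
    finally show ?thesis .
  qed
  have h_mem: "h i \<in> wires i" if "i \<in> B" for i using h that by auto
  have p_pos: "0 < p r x" for r x
    unfolding p_def by (intro prod_pos factor_pos h_mem) (auto simp: Br_def)
  have q_nonneg: "0 \<le> qb r x" "0 \<le> ql x" "0 \<le> Q x" for r x
    using q(1) by (auto simp: qb_def ql_def Q_def intro!: prod_nonneg)
  have dp: "depends {i. blk i = r} (p r)" for r
    unfolding p_def[abs_def]
  proof (rule depends_prod)
    fix i assume "i \<in> Br r"
    then have i: "i \<in> B" "blk i = r" by (auto simp: Br_def)
    have "depends {i. blk i = r} (edge (Z i) (h i) i)"
      using i blk_Z[OF i(1)] blk_A leaf_in_block[OF h i] by (intro depends_edge) auto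
    then show "depends {i. blk i = r} (\<lambda>x. 1 + \<delta> * edge (Z i) (h i) i x)"
      unfolding depends_def by metis
  qed
  have dq: "depends {i. blk i = r} (qb r)" for r
    unfolding qb_def[abs_def] by (rule depends_prod_coordinates) (auto simp: Vr_def)
  have dl: "depends (- {i. blk i < R}) (\<lambda>x. sqrt (ql x))"
    unfolding ql_def[abs_def] depends_def by (auto intro!: arg_cong[of _ _ sqrt] prod.cong)
  have dpq: "depends {i. blk i = r} (\<lambda>x. sqrt (p r x * qb r x))" for r
    using depends_mult[OF dp dq, of r] unfolding depends_def by metis
  have block: "?M (\<lambda>x. sqrt (p r x * qb r x)) \<le> sqrt (1 - (3 / 32 * (\<delta> * sqrt N))\<^sup>2)" if r: "r < R" for r
  proof -
    have sub: "Br r \<subseteq> B" by (auto simp: Br_def)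
    \<comment> \<open>One block is a leaf model on the same nodes, with the leaves of the other
      blocks demoted to free bits.\<close>
    interpret sub: leaf_model V "Br r" A Z \<delta>
      using finV BV AV A_ne ZV \<delta> sub by unfold_locales blast+
    have hr: "restrict h (Br r) \<in> PiE (Br r) sub.wires"
      using h_mem by (auto simp: sub.wires_def wires_def Br_def)
    have pr: "sub.density (restrict h (Br r)) = p r"
      by (auto simp: sub.density_def p_def fun_eq_iff)
    have "3 / 16 * (\<delta> * sqrt (card (Br r)))
        \<le> ?M (\<lambda>x. \<bar>sub.density (restrict h (Br r)) x - (\<Prod>i\<in>Vr r. q i (x i))\<bar>)"
      using A0_subset[OF r] leaves_nonempty[OF r] leaf_in_block[OF h] \<kappa> card_B[OF r] blk_A
      by (intro sub.density_far_from_product[OF hr, of _ "A0 r"] q) (auto simp: Br_def Vr_def)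
    then have far: "3 / 32 * (\<delta> * sqrt N) \<le> ?M (\<lambda>x. \<bar>p r x - qb r x\<bar>) / 2"
      using card_B[OF r, folded Br_def] by (simp add: pr qb_def)
    have "?M (\<lambda>x. sqrt (p r x * qb r x)) \<le> sqrt (1 - (?M (\<lambda>x. \<bar>p r x - qb r x\<bar>) / 2)\<^sup>2)"
    proof (rule mean_sqrt_mult_le)
      show "?M (p r) = 1" using sub.mean_density[OF hr] by (simp add: pr)
      show "?M (qb r) = 1"
        unfolding qb_def[abs_def] using finV q(2) by (intro mean_prod_coordinates) (auto simp: Vr_def)
    qed (use finV p_pos q_nonneg in \<open>auto intro: less_imp_le\<close>)
    also have "\<dots> \<le> sqrt (1 - (3 / 32 * (\<delta> * sqrt N))\<^sup>2)"
    proof -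
      have "(3 / 32 * (\<delta> * sqrt N))\<^sup>2 \<le> (?M (\<lambda>x. \<bar>p r x - qb r x\<bar>) / 2)\<^sup>2"
        using far \<delta> by (intro power_mono) auto
      then show ?thesis by simp
    qed
    finally show ?thesis .
  qed
  have "1 - ?M (\<lambda>x. \<bar>density h x - Q x\<bar>) / 2
      = ?M (\<lambda>x. density h x + Q x - \<bar>density h x - Q x\<bar>) / 2"
    using mean_density[OF h] mean_prod_coordinates[where q = q, OF finV order_refl q(2)]
    by (simp add: mean_add mean_diff Q_def diff_divide_distrib)
  also have "\<dots> = ?M (\<lambda>x. (density h x + Q x - \<bar>density h x - Q x\<bar>) / 2)"
    by (simp add: mean_divide)
  also have "\<dots> \<le> ?M (\<lambda>x. (\<Prod>r<R. sqrt (p r x * qb r x)) * sqrt (ql x))"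
  proof (rule mean_mono)
    fix x
    have d: "0 < density h x" by (rule density_pos[OF h])
    have "(density h x + Q x - \<bar>density h x - Q x\<bar>) / 2 = min (density h x) (Q x)" by auto
    also have "\<dots> = sqrt (min (density h x) (Q x) * min (density h x) (Q x))"
      using d q_nonneg(3)[of x] by simp
    also have "\<dots> \<le> sqrt (density h x * Q x)"
      using d q_nonneg(3)[of x] by (intro real_sqrt_le_mono mult_mono) auto
    also have "\<dots> = (\<Prod>r<R. sqrt (p r x * qb r x)) * sqrt (ql x)"
    proof -
      have "sqrt (\<Prod>r\<in>I. f r) = (\<Prod>r\<in>I. sqrt (f r))" for I :: "nat set" and f :: "nat \<Rightarrow> real"
        by (induction I rule: infinite_finite_induct) (auto simp: real_sqrt_mult)
      then show ?thesis
        by (simp add: p_eq Q_eq real_sqrt_mult prod.distrib)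
    qed
    finally show "(density h x + Q x - \<bar>density h x - Q x\<bar>) / 2
        \<le> (\<Prod>r<R. sqrt (p r x * qb r x)) * sqrt (ql x)" .
  qed
  also have "\<dots> = ?M (\<lambda>x. \<Prod>r<R. sqrt (p r x * qb r x)) * ?M (\<lambda>x. sqrt (ql x))"
  proof (rule mean_indep[OF _ dl])
    show "depends {i. blk i < R} (\<lambda>x. \<Prod>r<R. sqrt (p r x * qb r x))"
      by (intro depends_prod depends_mono[OF dpq]) auto
  qed
  also have "\<dots> = (\<Prod>r<R. ?M (\<lambda>x. sqrt (p r x * qb r x))) * ?M (\<lambda>x. sqrt (ql x))"
    using finV dpq by (subst mean_blocks[where S = "\<lambda>r. {i. blk i = r}"]) (auto simp: disjoint_family_on_def)
  also have "\<dots> \<le> (\<Prod>r<R. sqrt (1 - (3 / 32 * (\<delta> * sqrt N))\<^sup>2)) * 1"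
  proof (rule mult_mono)
    show "(\<Prod>r<R. ?M (\<lambda>x. sqrt (p r x * qb r x))) \<le> (\<Prod>r<R. sqrt (1 - (3 / 32 * (\<delta> * sqrt N))\<^sup>2))"
      using block p_pos q_nonneg by (intro prod_mono conjI mean_nonneg) (auto simp: less_imp_le)
    have "sqrt (ql x) \<le> (1 + ql x) / 2" for x
      using arith_geo_mean_sqrt[of 1 "ql x"] q_nonneg by simp
    then have "?M (\<lambda>x. sqrt (ql x)) \<le> ?M (\<lambda>x. (1 + ql x) / 2)" by (intro mean_mono)
    also have "\<dots> = 1"
      using mean_prod_coordinates[where q = q, OF finV _ q(2), of "{i \<in> V. \<not> blk i < R}"] finV
      by (simp add: mean_divide mean_add mean_const ql_def)
    finally show "?M (\<lambda>x. sqrt (ql x)) \<le> 1" .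
    have "(3 / 32 * (\<delta> * sqrt N))\<^sup>2 \<le> 1"
      using \<kappa> \<delta> by (simp add: abs_square_le_1)
    then show "0 \<le> (\<Prod>r<R. sqrt (1 - (3 / 32 * (\<delta> * sqrt N))\<^sup>2))" by (intro prod_nonneg) auto
    show "0 \<le> ?M (\<lambda>x. sqrt (ql x))" using q_nonneg by (intro mean_nonneg) auto
  qed
  finally show ?thesis by (simp add: Q_def)
qed

end

section \<open>The lower bound\<close>

text \<open>Node \<open>i\<close> will lie in block \<open>i div M\<close> at position
  \<open>i mod M\<close>; written as intervals, the parts of a block have evident
  cardinalities.\<close>

lemma div_mod_interval:
  fixes M :: nat
  assumes "b \<le> M"
  shows "{i. i div M = r \<and> a \<le> i mod M \<and> i mod M < b} = {r * M + a..<r * M + b}"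
proof (intro equalityI subsetI)
  fix i assume "i \<in> {i. i div M = r \<and> a \<le> i mod M \<and> i mod M < b}"
  then show "i \<in> {r * M + a..<r * M + b}"
    using div_mult_mod_eq[of i M] by auto
next
  fix i assume i: "i \<in> {r * M + a..<r * M + b}"
  define c where "c = i - r * M"
  have "i = r * M + c" "a \<le> c" "c < b" using i by (auto simp: c_def)
  then show "i \<in> {i. i div M = r \<and> a \<le> i mod M \<and> i mod M < b}"
    using assms by simp
qed

lemma pmf_bool_add: "pmf p True + pmf p False = 1"
  using sum_pmf_eq_1[OF finite subset_UNIV, of p] by (simp add: UNIV_bool)

lemma (in block_model) far_from_product_density:
  assumes V: "V = {..<n}" and n: "n > 0" and h: "h \<in> PiE B wires"
    and P: "has_density n P (density h)"
    and \<epsilon>: "\<epsilon> \<le> 3 / 32 * (\<delta> * sqrt N) \<or> \<epsilon> \<le> 1 - sqrt (1 - (3 / 32 * (\<delta> * sqrt N))\<^sup>2) ^ R"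
  shows "far_from_product n \<epsilon> P"
  unfolding far_from_product_def
proof (intro allI impI)
  fix Q assume "product_dist n Q"
  then obtain q where Q: "has_density n Q (\<lambda>x. \<Prod>i<n. q i (x i))"
    and q: "\<And>i b. 0 \<le> q i b" "\<And>i. (q i True + q i False) / 2 = (1 :: real)"
    using product_dist_has_density[OF n] by blast
  show "\<epsilon> \<le> d_TV n P Q"
    using density_far_small[where q = q, OF h q] density_far_large[where q = q, OF h q] \<epsilon>
    unfolding d_TV_has_density[OF P Q] V cube_eq_cube_on by linarith
qed

text \<open>Le Cam's method: the tester says \<open>True\<close> with probability at least 2/3 under
  the uniform distribution and at most 1/3 under the mixture. So the likelihood ratio differs from 1
  by at least 1/3 on average, and the square of this is bounded by the relative entropy.\<close>

lemma (in block_model) tester_relative_entropy_bound: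
  assumes V: "V = {..<n}" and n: "n > 0" and tester: "independence_tester n d \<epsilon> m T"
    and d: "\<And>i. i \<in> B \<Longrightarrow> card (Z i) < d"
    and \<epsilon>: "\<epsilon> \<le> 3 / 32 * (\<delta> * sqrt N) \<or> \<epsilon> \<le> 1 - sqrt (1 - (3 / 32 * (\<delta> * sqrt N))\<^sup>2) ^ R"
    and N: "\<And>i. i \<in> B \<Longrightarrow> card (A i) = N'" and k: "\<And>i. i \<in> B \<Longrightarrow> card (Z i) = k"
    and t: "real m * \<delta>\<^sup>2 \<le> 2 ^ k"
  shows "1 / 9 \<le> 4 * (card B / N' * (exp ((real m)\<^sup>2 * \<delta> ^ 4 / 2 ^ k) - 1))"
proof -
  let ?M = "mean (samples m (cube_on V)) :: _ \<Rightarrow> real"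
  let ?L = "\<lambda>xs. \<Prod>i\<in>B. lik i xs"
  define acc where "acc xs = pmf (T xs) True" for xs
  have acc: "0 \<le> acc xs" "acc xs \<le> 1" for xs by (auto simp: acc_def pmf_nonneg pmf_le_1)
  have cube: "cube_on V = cube n" by (simp add: V cube_eq_cube_on)
  obtain U where U: "has_density n U (\<lambda>_. 1)"
    using ex_has_density[of "\<lambda>_. 1" n] finV by (auto simp: cube[symmetric] mean_const)
  have "2 / 3 \<le> pmf (output_dist m T U) True"
    using tester bayes_net_uniform[OF U] product_dist_uniform[OF U]
    by (auto simp: independence_tester_def)
  also have "\<dots> = ?M acc"
    by (simp add: output_dist_has_density[OF U] cube acc_def[abs_def] map_replicate_const)
  finally have yes: "2 / 3 \<le> ?M acc" .
  have no: "?M (\<lambda>xs. (\<Prod>x\<leftarrow>xs. density h x) * acc xs) \<le> 1 / 3" if h: "h \<in> PiE B wires" for h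
  proof -
    obtain P where P: "has_density n P (density h)"
      using ex_has_density[of "density h" n] density_pos[OF h] mean_density[OF h]
      by (auto simp: cube less_imp_le)
    have "2 / 3 \<le> pmf (output_dist m T P) False"
      using tester bayes_net_has_density[OF V h P d] far_from_product_density[OF V n h P \<epsilon>]
      by (auto simp: independence_tester_def)
    then have "pmf (output_dist m T P) True \<le> 1 / 3"
      using pmf_bool_add[of "output_dist m T P"] by linarith
    then show ?thesis
      by (simp add: output_dist_has_density[OF P] cube acc_def)
  qed
  have "?M (\<lambda>xs. ?L xs * acc xs)
      = mean (PiE B wires) (\<lambda>h. ?M (\<lambda>xs. (\<Prod>x\<leftarrow>xs. density h x) * acc xs))"
    unfolding prod_lik_eq mean_multc[symmetric] by (rule mean_swap)
  also have "\<dots> \<le> mean (PiE B wires) (\<lambda>h. 1 / 3)"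
    by (intro mean_mono no)
  also have "\<dots> = 1 / 3"
    using finB finite_wires wires_nonempty by (intro mean_const) (auto simp: finite_PiE PiE_eq_empty_iff)
  finally have "1 / 3 \<le> ?M (\<lambda>xs. acc xs - ?L xs * acc xs)"
    using yes by (simp add: mean_diff)
  also have "\<dots> \<le> ?M (\<lambda>xs. \<bar>?L xs - 1\<bar>)"
  proof (rule mean_mono)
    fix xs
    have "acc xs - ?L xs * acc xs = (1 - ?L xs) * acc xs" by (simp add: algebra_simps)
    also have "\<dots> \<le> \<bar>1 - ?L xs\<bar> * acc xs" using acc by (intro mult_right_mono) auto
    also have "\<dots> \<le> \<bar>1 - ?L xs\<bar> * 1" using acc by (intro mult_left_mono) auto
    finally show "acc xs - ?L xs * acc xs \<le> \<bar>?L xs - 1\<bar>" by (simp add: abs_minus_commute)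
  qed
  finally have "(1 / 3)\<^sup>2 \<le> (?M (\<lambda>xs. \<bar>?L xs - 1\<bar>))\<^sup>2"
    by (intro power_mono) auto
  also have "\<dots> \<le> 4 * (card B / N' * (exp ((real m)\<^sup>2 * \<delta> ^ 4 / 2 ^ k) - 1))"
    by (rule mean_abs_lik_diff_le[OF N k t])
  finally show ?thesis by (simp add: power_divide)
qed

text \<open>The scaling gives \<open>\<delta> * sqrt N = 32 * \<epsilon>'\<close>. So the one-block
  distance becomes \<open>3 * \<epsilon>'\<close>, and \<open>\<epsilon>' \<le> 1 / 64\<close> is
  the condition \<open>\<delta> * sqrt N \<le> 1 / 2\<close>.\<close>

lemma tester_entropy_bound:
  fixes \<epsilon> \<epsilon>' \<delta> :: real and R k N :: nat
  assumes tester: "independence_tester n d \<epsilon> m T"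
    and size: "R * (k + 2 * N) \<le> n" "R > 0" "N > 0" "k < d"
    and \<epsilon>': "0 \<le> \<epsilon>'" "\<epsilon>' \<le> 1 / 64" and \<delta>: "\<delta> = 32 * \<epsilon>' / sqrt N"
    and \<epsilon>: "\<epsilon> \<le> \<epsilon>' \<or> \<epsilon> \<le> 1 - sqrt (1 - \<epsilon>'\<^sup>2) ^ R"
    and t: "real m * \<delta>\<^sup>2 \<le> 2 ^ k"
  shows "1 / 9 \<le> 4 * (R * (exp ((real m)\<^sup>2 * \<delta> ^ 4 / 2 ^ k) - 1))"
proof -
  \<comment> \<open>Positions within a block of length \<open>M\<close>: first \<open>k\<close>
    pointers, then \<open>N\<close> candidates, then \<open>N\<close> leaves.\<close>
  define M where "M = k + 2 * N"
  define B where "B = {i. i div M < R \<and> k + N \<le> i mod M}"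
  define A0 where "A0 r = {j. j div M = r \<and> k \<le> j mod M \<and> j mod M < k + N}" for r
  define Z where "Z i = {j. j div M = i div M \<and> j mod M < k}" for i
  have M: "M > 0" using size by (simp add: M_def)
  have V: "i < n" if "i div M < R" for i
    using that M size(1) by (simp add: div_less_iff_less_mult M_def)
  have Br: "{i \<in> B. i div M = r} = {r * M + (k + N)..<r * M + M}" if "r < R" for r
    unfolding div_mod_interval[OF order_refl, symmetric] using that M by (auto simp: B_def)
  have cardBr: "card {i \<in> B. i div M = r} = N" if "r < R" for r
    unfolding Br[OF that] by (simp add: M_def)
  have "A0 r = {r * M + k..<r * M + (k + N)}" for r
    unfolding A0_def by (rule div_mod_interval) (simp add: M_def)
  then have cardA: "card (A0 r) = N" for r by simp
  have "Z i = {i div M * M + 0..<i div M * M + k}" for i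
    unfolding Z_def using div_mod_interval[of k M "i div M" 0] by (simp add: M_def)
  then have cardZ: "card (Z i) = k" for i by simp
  have cardB: "card B = R * N"
  proof -
    have "B = (\<Union>r<R. {i \<in> B. i div M = r})" by (auto simp: B_def)
    then have "card B = card (\<Union>r<R. {i \<in> B. i div M = r})" by simp
    also have "\<dots> = (\<Sum>r<R. card {i \<in> B. i div M = r})"
      by (rule card_UN_disjoint) (simp, simp add: Br, auto)
    finally show ?thesis by (simp add: cardBr)
  qed
  have sN: "1 \<le> sqrt N" using size by simp
  have \<delta>': "\<delta> * sqrt N = 32 * \<epsilon>'" using size by (simp add: \<delta>)
  have "\<delta> \<le> 32 * \<epsilon>' / 1"
    unfolding \<delta> using \<epsilon>' sN by (intro divide_left_mono) auto
  then have "\<delta> < 1" using \<epsilon>' by simp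
  interpret block_model "{..<n}" B "\<lambda>i. A0 (i div M)" Z \<delta> "\<lambda>i. i div M" A0 R N
  proof unfold_locales
    show "B \<subseteq> {..<n}" using V by (auto simp: B_def)
    show "A0 (i div M) \<subseteq> {..<n} - B" if "i \<in> B" for i
      using that V by (auto simp: A0_def B_def)
    show "A0 (i div M) \<noteq> {}" for i using cardA[of "i div M"] size(3) by auto
    show "Z i \<subseteq> {..<n} - B - A0 (i div M)" if "i \<in> B" for i
      using that V by (auto simp: A0_def B_def Z_def)
    show "0 \<le> \<delta>" using \<epsilon>' by (simp add: \<delta>)
  qed (use \<epsilon>' size cardBr \<delta>' \<open>\<delta> < 1\<close> in \<open>auto simp: B_def A0_def Z_def\<close>)
  have n: "n > 0" using size by (metis add_gr_0 gr_zeroI le_zero_eq mult_pos_pos zero_less_numeral)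
  have "\<epsilon> \<le> 3 * \<epsilon>' \<or> \<epsilon> \<le> 1 - sqrt (1 - (3 * \<epsilon>')\<^sup>2) ^ R"
  proof -
    have "\<epsilon>'\<^sup>2 \<le> (3 * \<epsilon>')\<^sup>2" "(3 * \<epsilon>')\<^sup>2 \<le> 1\<^sup>2" using \<epsilon>' by (intro power_mono; simp)+
    then have "sqrt (1 - (3 * \<epsilon>')\<^sup>2) ^ R \<le> sqrt (1 - \<epsilon>'\<^sup>2) ^ R"
      by (intro power_mono) auto
    then show ?thesis using \<epsilon> \<epsilon>' by linarith
  qed
  then have "1 / 9 \<le> 4 * (real (card B) / N * (exp ((real m)\<^sup>2 * \<delta> ^ 4 / 2 ^ k) - 1))"
    using tester size t cardA cardZ n
    by (intro tester_relative_entropy_bound[of n d \<epsilon> m T]) (auto simp: \<delta>')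
  then show ?thesis using size by (simp add: cardB)
qed

text \<open>The uniform distribution is within \<open>1 - 1 / 2 ^ n\<close> of every distribution on
  the cube, so for \<open>\<epsilon>\<close> above this value nothing is far and no samples are
  needed. Hence \<open>\<epsilon>\<close> is kept below a constant
  \<open>\<epsilon>\<^sub>0 < 1\<close> that is fixed before \<open>n\<^sub>0\<close>. For
  \<open>d = 0\<close> all Bayes nets are products, hence \<open>1 \<le> d\<close>.\<close>

theorem theorem4p1:
  shows "\<exists>c::real. c > 0 \<and>
    (\<forall>\<epsilon>\<^sub>0::real. 0 < \<epsilon>\<^sub>0 \<and> \<epsilon>\<^sub>0 < 1 \<longrightarrow>
      (\<exists>C::real. C > 0 \<and> (\<exists>n\<^sub>0::nat.
        \<forall>n d :: nat. n \<ge> n\<^sub>0 \<longrightarrow> 1 \<le> d \<longrightarrow> real d \<le> c * ln (real n) \<longrightarrow>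
          (\<forall>(\<epsilon>::real) (m::nat) (A::algorithm).
             0 < \<epsilon> \<longrightarrow> \<epsilon> \<le> \<epsilon>\<^sub>0 \<longrightarrow> independence_tester n d \<epsilon> m A \<longrightarrow>
               real m \<ge> C * (2 powr (real d / 2) * real n / \<epsilon>\<^sup>2)))))"
proof (rule exI[of _ "1::real"], intro conjI allI impI)
  show "(0::real) < 1" by simp
next
  fix \<epsilon>\<^sub>0 :: real assume \<epsilon>\<^sub>0: "0 < \<epsilon>\<^sub>0 \<and> \<epsilon>\<^sub>0 < 1"
  \<comment> \<open>Enough blocks to raise the distance from the order of 1/64 to
    \<open>\<epsilon>\<^sub>0\<close>.\<close>
  have "sqrt (1 - (1 / 64)\<^sup>2) < (1::real)" "0 < 1 - \<epsilon>\<^sub>0"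
    using \<epsilon>\<^sub>0 by (simp_all add: power2_eq_square)
  then obtain R where R: "sqrt (1 - (1 / 64)\<^sup>2) ^ R < 1 - \<epsilon>\<^sub>0"
    using real_arch_pow_inv by blast
  have R0: "R > 0" using R \<epsilon>\<^sub>0 by (cases R) auto
  \<comment> \<open>\<open>147456 = 32\<^sup>2 * 16 * 9\<close>: 32 from \<open>\<delta>\<close>, 16
    from \<open>2 * sqrt D\<close> and \<open>8 * R * N\<close>, and 9 so that the final
    contradiction has room.\<close>
  define C where "C = 1 / (147456 * (real R)\<^sup>2)"
  have "eventually (\<lambda>n. dist (ln (real n) / real n) 0 < 1 / (2 * real R)) sequentially"
    using tendstoD[OF lim_ln_over_n] R0 by simp
  then obtain n\<^sub>1 where n\<^sub>1: "\<And>n. n \<ge> n\<^sub>1 \<Longrightarrow> dist (ln (real n) / real n) 0 < 1 / (2 * real R)"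
    by (auto simp: eventually_sequentially)
  show "\<exists>C::real. C > 0 \<and> (\<exists>n\<^sub>0::nat. \<forall>n d :: nat. n \<ge> n\<^sub>0 \<longrightarrow> 1 \<le> d \<longrightarrow> real d \<le> 1 * ln (real n) \<longrightarrow>
      (\<forall>(\<epsilon>::real) (m::nat) (A::algorithm).
         0 < \<epsilon> \<longrightarrow> \<epsilon> \<le> \<epsilon>\<^sub>0 \<longrightarrow> independence_tester n d \<epsilon> m A \<longrightarrow>
           real m \<ge> C * (2 powr (real d / 2) * real n / \<epsilon>\<^sup>2)))"
  proof (intro exI[of _ C] conjI exI[of _ "max n\<^sub>1 (8 * R)"] allI impI)
    show "C > 0" using R0 by (simp add: C_def)
  next
    fix n d :: nat and \<epsilon> :: real and m :: nat and T :: algorithm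
    assume n: "max n\<^sub>1 (8 * R) \<le> n" and d: "1 \<le> d" "real d \<le> 1 * ln (real n)"
      and \<epsilon>: "0 < \<epsilon>" "\<epsilon> \<le> \<epsilon>\<^sub>0" and tester: "independence_tester n d \<epsilon> m T"
    \<comment> \<open>One of the \<open>d\<close> parents is reserved for the candidate.\<close>
    define k where "k = d - 1"
    define N where "N = n div (4 * R)"
    \<comment> \<open>Up to 1/64 one block is far enough; beyond that \<open>\<epsilon>'\<close>
      stays at 1/64 and the choice of \<open>R\<close> takes over.\<close>
    define \<epsilon>' where "\<epsilon>' = min \<epsilon> (1 / 64)"
    define \<delta> where "\<delta> = 32 * \<epsilon>' / sqrt N"
    define D where "D = (2::real) ^ k"
    have n0: "real n > 0" using n R0 by auto
    have "ln (real n) / real n \<le> dist (ln (real n) / real n) 0"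
      by (simp only: dist_real_def diff_0_right abs_ge_self)
    also have "\<dots> < 1 / (2 * real R)" using n by (intro n\<^sub>1) simp
    finally have "ln (real n) / real n < 1 / (2 * real R)" .
    then have "real R * ln (real n) \<le> real n / 2"
      using R0 n0 by (simp add: field_simps)
    \<comment> \<open>The upper bound on \<open>d\<close> only has to keep the \<open>R * k\<close>
      pointer bits within half of the nodes, so \<open>c = 1\<close> suffices.\<close>
    moreover have "real R * real k \<le> real R * ln (real n)"
      using d by (intro mult_left_mono) (auto simp: k_def)
    ultimately have "real (2 * (R * k)) \<le> real n" by simp
    then have Rk: "2 * (R * k) \<le> n" by (simp only: of_nat_le_iff)
    have "4 * R * N \<le> n" unfolding N_def by (rule times_div_less_eq_dividend)
    then have size: "R * (k + 2 * N) \<le> n" using Rk by (simp add: algebra_simps)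
    have "n < 4 * R * (N + 1)" unfolding N_def using R0 by (simp add: dividend_less_times_div)
    \<comment> \<open>Here \<open>8 * R \<le> n\<close> absorbs the rounding: \<open>4 * R\<close>
      is at most \<open>n / 2\<close>.\<close>
    then have "n \<le> 8 * R * N" using n by (simp add: algebra_simps)
    then have "real n \<le> real (8 * R * N)" by (simp only: of_nat_le_iff)
    then have nN: "real n \<le> 8 * real R * real N" by simp
    then have N0: "N > 0" using n0 by (cases "N = 0") auto
    have \<epsilon>': "0 < \<epsilon>'" "\<epsilon>' \<le> 1 / 64" "\<epsilon>' \<le> \<epsilon>" using \<epsilon> by (auto simp: \<epsilon>'_def)
    have far: "\<epsilon> \<le> \<epsilon>' \<or> \<epsilon> \<le> 1 - sqrt (1 - \<epsilon>'\<^sup>2) ^ R"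
      using R \<epsilon> by (auto simp: \<epsilon>'_def min_def)
    show "real m \<ge> C * (2 powr (real d / 2) * real n / \<epsilon>\<^sup>2)"
    proof (rule ccontr)
      assume "\<not> ?thesis"
      then have m: "real m * \<epsilon>\<^sup>2 \<le> C * (2 powr (real d / 2) * real n)"
        using \<epsilon> by (simp add: field_simps)
      have D1: "1 \<le> D" by (simp add: D_def)
      have "2 powr (real d / 2) = sqrt 2 * sqrt D"
      proof -
        have "real d / 2 = (1 + real k) / 2" using d by (simp add: k_def of_nat_diff)
        then have "2 powr (real d / 2) = 2 powr (1 / 2) * (2 powr real k) powr (1 / 2)"
          by (simp add: powr_powr powr_add[symmetric] add_divide_distrib)
        then show ?thesis by (simp add: powr_half_sqrt powr_realpow D_def)
      qed
      also have "\<dots> \<le> 2 * sqrt D"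
        using sqrt2_less_2 D1 by (intro mult_right_mono) auto
      finally have p: "2 powr (real d / 2) \<le> 2 * sqrt D" .
      have "real m * \<epsilon>'\<^sup>2 \<le> real m * \<epsilon>\<^sup>2"
        using \<epsilon>' by (intro mult_left_mono power_mono) auto
      also note m
      also have "C * (2 powr (real d / 2) * real n) \<le> C * (2 * sqrt D * (8 * real R * real N))"
        using p nN D1 by (intro mult_left_mono mult_mono) (auto simp: C_def)
      finally have m': "real m * \<epsilon>'\<^sup>2 \<le> C * (2 * sqrt D * (8 * real R * real N))" .
      have "real m * \<delta>\<^sup>2 = 1024 * (real m * \<epsilon>'\<^sup>2) / N"
        by (simp add: \<delta>_def power_divide power_mult_distrib)
      also have "\<dots> \<le> 1024 * (C * (2 * sqrt D * (8 * real R * real N))) / N"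
        using m' by (intro divide_right_mono mult_left_mono) auto
      also have "\<dots> = sqrt D / (9 * real R)"
        using N0 R0 by (simp add: C_def field_simps power2_eq_square)
      finally have u: "real m * \<delta>\<^sup>2 \<le> sqrt D / (9 * real R)" .
      have R1: "1 \<le> real R" using R0 by simp
      have "sqrt D / (9 * real R) \<le> sqrt D / 1"
        using R1 D1 by (intro divide_left_mono) auto
      also have "\<dots> \<le> D" using D1 by (simp add: real_le_lsqrt power2_eq_square)
      finally have t: "real m * \<delta>\<^sup>2 \<le> 2 ^ k" using u by (simp add: D_def)
      define v where "v = (real m)\<^sup>2 * \<delta> ^ 4 / 2 ^ k"
      have "(real m)\<^sup>2 * \<delta> ^ 4 = (real m * \<delta>\<^sup>2)\<^sup>2"
        by (simp add: power_mult_distrib)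
      also have "\<dots> \<le> (sqrt D / (9 * real R))\<^sup>2"
        using u by (intro power_mono) auto
      also have "\<dots> = D / (81 * (real R)\<^sup>2)"
        using D1 by (simp add: power_divide power_mult_distrib)
      finally have "v \<le> D / (81 * (real R)\<^sup>2) / D"
        unfolding v_def D_def by (rule divide_right_mono) simp
      then have v: "v \<le> 1 / (81 * (real R)\<^sup>2)" using D1 by simp
      have v0: "0 \<le> v" by (simp add: v_def)
      have "1 / (81 * (real R)\<^sup>2) \<le> 1" using R1 by (simp add: field_simps power2_eq_square mult_ge1_I)
      then have v1: "v \<le> 1" using v by linarith
      have "exp v - 1 \<le> v + v\<^sup>2" using exp_bound[OF v0 v1] by simp
      also have "\<dots> \<le> 2 * v" using v0 v1 by (simp add: power2_eq_square mult_left_le)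
      also have "\<dots> \<le> 2 / (81 * (real R)\<^sup>2)" using v by simp
      finally have "4 * (real R * (exp v - 1)) \<le> 4 * (real R * (2 / (81 * (real R)\<^sup>2)))"
        using R1 by (intro mult_left_mono) auto
      also have "\<dots> = 8 / 81 / real R" using R1 by (simp add: field_simps power2_eq_square)
      also have "\<dots> \<le> 8 / 81 / 1" using R1 by (intro divide_left_mono) auto
      \<comment> \<open>The constant 9 in \<open>C\<close> yields 8/81, just below the required
        9/81.\<close>
      finally have "4 * (real R * (exp v - 1)) < 1 / 9" by simp
      moreover have "1 / 9 \<le> 4 * (real R * (exp v - 1))"
        unfolding v_def using d \<epsilon>'
        by (intro tester_entropy_bound[OF tester size R0 N0 _ _ _ \<delta>_def far t]) (auto simp: k_def)
      ultimately show False by linarith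
    qed
  qed
qed

end
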